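(* Let $\mathcal{G}$ be a connected (weighted, undirected) graph with $n$ vertices and Laplacian $\mathsf{L}\in\mathbb{R}^{n\times n}$, and let $\mathbf{L}=\mathsf{L}\otimes \mathsf{I}_d\in\mathbb{R}^{nd\times nd}$. Consider the optimization problem of minimizing $f(x)=\sum_{i=1}^n f^i(x)$ over $x\in\mathbb{R}^d$, where each $f^i:\mathbb{R}^d\to\mathbb{R}$, $i\in\{1,\dots,n\}$, is locally Lipschitz and convex. Let $\tilde f(\boldsymbol{x})=\sum_{i=1}^n f^i(x^i)$ for $\boldsymbol{x}=(x^1,\dots,x^n)\in(\mathbb{R}^d)^n$. Consider the set-valued dynamical system on $\mathbb{R}^{nd}\times\mathbb{R}^{nd}$ $$\dot{\boldsymbol{x}}+\mathbf{L}\boldsymbol{x}+\mathbf{L}\boldsymbol{z}\in-\partial\tilde f(\boldsymbol{x}),\qquad \dot{\boldsymbol{z}}=\mathbf{L}\boldsymbol{x}.$$ Then the projection onto the first component $\boldsymbol{x}(t)$ of any trajectory $(\boldsymbol{x}(t),\boldsymbol{z}(t))$ of this system asymptotically converges, as $t\to\infty$, to the set of solutions of the problem $$\text{minimize } \tilde f(\boldsymbol{x})\quad\text{subject to}\quad \mathbf{L}\boldsymbol{x}=\mathbf{0}_{nd}.$$ Moreover, if $f$ has a finite number of critical points, the limit of the projection onto the first component of each trajectory is a solution of this constrained problem.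
   Context: A weighted digraph is $\mathcal{G}=(\mathcal{V},\mathcal{E},\mathsf{A})$ with finite vertex set $\mathcal{V}=\{v_1,\dots,v_n\}$, edge set $\mathcal{E}\subseteq\mathcal{V}\times\mathcal{V}$, and adjacency matrix $\mathsf{A}=(a_{ij})\in\mathbb{R}_{\ge0}^{n\times n}$ with $a_{ij}>0$ if $(v_i,v_j)\in\mathcal{E}$ and $a_{ij}=0$ otherwise. Its Laplacian is $\mathsf{L}=\mathsf{D}_{\mathrm{out}}-\mathsf{A}$, where $\mathsf{D}_{\mathrm{out}}$ is the diagonal matrix with diagonal entries $\sum_{j}a_{ij}$. It is undirected (called a graph) if $\mathsf{L}=\mathsf{L}^T$. A graph is connected if there is a path between any two distinct vertices. $\mathsf{I}_d$ is the $d\times d$ identity matrix, $\otimes$ the Kronecker product, and $\mathbf{0}_{nd}$ the zero vector in $\mathbb{R}^{nd}$. For a locally Lipschitz $g:\mathbb{R}^m\to\mathbb{R}$, $\partial g(x)$ denotes the generalized gradient, $\partial g(x)=\mathrm{co}\{\lim_{k\to\infty}\nabla g(x_k) : x_k\to x,\ x_k\notin\Omega_g\cup S\}$, where $\Omega_g$ is the set of points where $g$ is not differentiable, $S$ is any set of measure zero and $\mathrm{co}$ is the convex hull. A critical point of $g$ is a point $x$ with $0\in\partial g(x)$. A solution (trajectory) of a set-valued dynamical system is an absolutely continuous curve satisfying the differential inclusion for almost every time.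
   Formalization: The constrained problem is additionally assumed to have at least one solution; without this the claim fails, e.g. for n = d = 1 and f = exp, where x' = -exp(x) diverges and f has no critical points. *)

theory Defs
  imports "HOL-Analysis.Analysis"
begin

text \<open>
  Vertices form a finite type \<open>'n\<close>, agent states live in \<open>real ^ 'd\<close>, and network states live in
  \<open>real ^ ('n \<times> 'd)\<close>: the entry at index \<open>(i, k)\<close> is the \<open>k\<close>-th coordinate of agent \<open>i\<close>.
\<close>

section \<open>Weighted digraphs\<close>

definition weighted_digraph :: "('n \<times> 'n) set \<Rightarrow> real ^ 'n ^ 'n \<Rightarrow> bool" where
  "weighted_digraph E A \<longleftrightarrow>
     (\<forall>i j. ((i, j) \<in> E \<longrightarrow> A $ i $ j > 0) \<and> ((i, j) \<notin> E \<longrightarrow> A $ i $ j = 0))"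

definition out_degree_matrix :: "real ^ 'n ^ 'n \<Rightarrow> real ^ 'n ^ 'n" where
  "out_degree_matrix A = (\<chi> i j. if i = j then (\<Sum>k\<in>UNIV. A $ i $ k) else 0)"

definition laplacian :: "real ^ 'n ^ 'n \<Rightarrow> real ^ 'n ^ 'n" where
  "laplacian A = out_degree_matrix A - A"

definition undirected :: "real ^ 'n ^ 'n \<Rightarrow> bool" where
  "undirected A \<longleftrightarrow> laplacian A = transpose (laplacian A)"

definition connected_graph :: "('n \<times> 'n) set \<Rightarrow> bool" where
  "connected_graph E \<longleftrightarrow> (\<forall>i j. i \<noteq> j \<longrightarrow> (i, j) \<in> E\<^sup>+)"

definition kronecker ::
    "real ^ 'b::finite ^ 'a::finite \<Rightarrow> real ^ 'd::finite ^ 'c::finite \<Rightarrow> real ^ ('b \<times> 'd) ^ ('a \<times> 'c)" where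
  "kronecker M N = (\<chi> p q. M $ fst p $ fst q * N $ snd p $ snd q)"

definition network_laplacian ::
    "real ^ 'n ^ 'n \<Rightarrow> real ^ ('n::finite \<times> 'd::finite) ^ ('n \<times> 'd)" where
  "network_laplacian A = kronecker (laplacian A) (mat 1)"

section \<open>Nonsmooth analysis\<close>

definition locally_lipschitz :: "('a::metric_space \<Rightarrow> 'b::metric_space) \<Rightarrow> bool" where
  "locally_lipschitz g \<longleftrightarrow> (\<forall>x. \<exists>u>0. \<exists>C. C-lipschitz_on (cball x u) g)"

definition nondifferentiability_set :: "('a::euclidean_space \<Rightarrow> real) \<Rightarrow> 'a set" where
  "nondifferentiability_set g = {x. \<not> g differentiable (at x)}"

text \<open>Meaningful only at points of differentiability.\<close>

definition gradient :: "('a::euclidean_space \<Rightarrow> real) \<Rightarrow> 'a \<Rightarrow> 'a" where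
  "gradient g x = (THE D. GDERIV g x :> D)"

text \<open>
  The excluded set \<open>S\<close> is meant to be an arbitrary null set. For locally Lipschitz \<open>g\<close> the result
  does not depend on it; it is kept as a parameter over which statements are quantified.
\<close>

definition generalized_gradient ::
    "'a set \<Rightarrow> ('a::euclidean_space \<Rightarrow> real) \<Rightarrow> 'a \<Rightarrow> 'a set" where
  "generalized_gradient S g x =
     convex hull {v. \<exists>\<xi>. \<xi> \<longlonglongrightarrow> x \<and> (\<forall>k. \<xi> k \<notin> nondifferentiability_set g \<union> S) \<and>
                         (\<lambda>k. gradient g (\<xi> k)) \<longlonglongrightarrow> v}"

definition critical_points ::
    "'a set \<Rightarrow> ('a::euclidean_space \<Rightarrow> real) \<Rightarrow> 'a set" where
  "critical_points S g = {x. 0 \<in> generalized_gradient S g x}"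

section \<open>Set-valued dynamical systems\<close>

text \<open>
  The usual \<open>\<epsilon>\<close>-\<open>\<delta>\<close> notion. A set \<open>D\<close> with \<open>D division_of \<Union>D\<close> is a finite family of nonempty compact
  intervals with pairwise disjoint interiors.
\<close>

definition absolutely_continuous_on :: "real set \<Rightarrow> (real \<Rightarrow> 'a::real_normed_vector) \<Rightarrow> bool" where
  "absolutely_continuous_on J \<gamma> \<longleftrightarrow>
     (\<forall>\<epsilon>>0. \<exists>\<delta>>0. \<forall>D. D division_of \<Union>D \<and> \<Union>D \<subseteq> J \<and> (\<Sum>K\<in>D. Sup K - Inf K) < \<delta> \<longrightarrow>
        (\<Sum>K\<in>D. norm (\<gamma> (Sup K) - \<gamma> (Inf K))) < \<epsilon>)"

text \<open>
  Trajectories are defined on \<open>[0, \<infinity>)\<close>; the values of \<open>\<gamma>\<close> at negative times are irrelevant.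
  Absolute continuity on this unbounded interval is understood on its compact subintervals.
\<close>

definition trajectory :: "('a::euclidean_space \<Rightarrow> 'a set) \<Rightarrow> (real \<Rightarrow> 'a) \<Rightarrow> bool" where
  "trajectory F \<gamma> \<longleftrightarrow>
     (\<forall>T>0. absolutely_continuous_on {0..T} \<gamma>) \<and>
     (AE t in lebesgue. t \<ge> 0 \<longrightarrow>
        (\<exists>v\<in>F (\<gamma> t). (\<gamma> has_vector_derivative v) (at t within {0..})))"

section \<open>Distributed optimization\<close>

definition agent_state :: "real ^ ('n::finite \<times> 'd::finite) \<Rightarrow> 'n \<Rightarrow> real ^ 'd" where
  "agent_state x i = (\<chi> k. x $ (i, k))"

definition total_cost :: "('n::finite \<Rightarrow> real ^ 'd::finite \<Rightarrow> real) \<Rightarrow> real ^ 'd \<Rightarrow> real" where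
  "total_cost f y = (\<Sum>i\<in>UNIV. f i y)"

definition network_cost ::
    "('n::finite \<Rightarrow> real ^ 'd::finite \<Rightarrow> real) \<Rightarrow> real ^ ('n \<times> 'd) \<Rightarrow> real" where
  "network_cost f x = (\<Sum>i\<in>UNIV. f i (agent_state x i))"

definition optimization_dynamics ::
    "(real ^ ('n \<times> 'd)) set \<Rightarrow> real ^ 'n ^ 'n \<Rightarrow> ('n::finite \<Rightarrow> real ^ 'd::finite \<Rightarrow> real) \<Rightarrow>
     (real ^ ('n \<times> 'd)) \<times> (real ^ ('n \<times> 'd)) \<Rightarrow>
     ((real ^ ('n \<times> 'd)) \<times> (real ^ ('n \<times> 'd))) set" where
  "optimization_dynamics S A f = (\<lambda>(x, z).
     {(u, w). u + network_laplacian A *v x + network_laplacian A *v z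
                \<in> uminus ` generalized_gradient S (network_cost f) x \<and>
              w = network_laplacian A *v x})"

definition constrained_solutions ::
    "real ^ 'n ^ 'n \<Rightarrow> ('n::finite \<Rightarrow> real ^ 'd::finite \<Rightarrow> real) \<Rightarrow> (real ^ ('n \<times> 'd)) set" where
  "constrained_solutions A f =
     {x. is_arg_min (network_cost f) (\<lambda>y. network_laplacian A *v y = 0) x}"

end

theory Submission
  imports Defs
begin

text \<open>
  The problem with constraint \<open>L x = 0\<close>, where \<open>L\<close> is the network Laplacian, has a saddle point
  \<open>(x0, z0)\<close>: \<open>x0\<close> is a solution, and separation of convex sets (\<open>convex_lagrange_multiplier\<close>)
  yields \<open>z0\<close> with \<open>g x - g x0 + z0 \<bullet> L x \<ge> 0\<close> for all \<open>x\<close>, where \<open>g\<close> is the network cost. Let \<open>V\<close> be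
  half the squared distance to \<open>(x0, z0)\<close>. Generalized gradients of convex functions consist of
  subgradients, so along a trajectory \<open>V\<close> has derivative at most \<open>- W\<close>
  (\<open>V_derivative_le\<close>) with
  \<open>W x = x \<bullet> L x + (g x - g x0 + z0 \<bullet> L x)\<close>. Both summands are nonnegative. If both vanish, then
  \<open>L x = 0\<close>, because \<open>L\<close> is positive semidefinite, and hence \<open>g x = g x0\<close>: the zeros of \<open>W\<close> are solutions
  of the constrained problem.

  Since \<open>V\<close> decreases, the trajectory is bounded. Then its velocities, built from bounded
  subgradients, are bounded as well, so \<open>W\<close> is uniformly continuous in time and Barbalat's argument
  gives \<open>W \<rightarrow> 0\<close> (\<open>W_tendsto_0\<close>). Compactness turns this into convergence to the set of solutions. The
  passage from almost everywhere statements on derivatives to increments is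
  \<open>absolutely_continuous_increment_le\<close>.

  For the second claim, connectedness identifies the solutions with the minimizers of the total
  cost (\<open>constrained_solutions_eq\<close>). Every minimizer of a convex function is a critical point in
  the sense of limits of gradients (\<open>convex_minimizer_critical\<close>); this rests on differentiability almost
  everywhere (\<open>negligible_nondifferentiability_convex\<close>). If there are finitely many critical
  points, the convex set of minimizers is a single point, and convergence to the set is convergence
  to that point.
\<close>

section \<open>Increments of absolutely continuous curves\<close>

text \<open>
The Henstock form of the statement that an absolutely continuous function is recovered from its
derivative. Off the null set \<open>N\<close> a fine enough interval around \<open>t\<close> has an increment of at most
\<open>c + \<kappa>\<close> times its length; the intervals tagged in \<open>N\<close> fit into an open set of measure below
\<open>\<delta>\<close>, where absolute continuity makes their total contribution small. The function
\<open>g\<close> stands for a scalar observable of the curve \<open>\<gamma>\<close>, such as a Lyapunov function.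
\<close>
lemma absolutely_continuous_increment_le:
  fixes \<gamma> :: "real \<Rightarrow> 'a::real_normed_vector" and g :: "real \<Rightarrow> real"
  assumes ab: "a \<le> b" and ac: "absolutely_continuous_on {a..b} \<gamma>"
    and dom: "\<And>u v. a \<le> u \<Longrightarrow> u \<le> v \<Longrightarrow> v \<le> b \<Longrightarrow> g v - g u \<le> K * norm (\<gamma> v - \<gamma> u)"
    and N: "negligible N"
    and der: "\<And>t. t \<in> {a..b} - N \<Longrightarrow> \<exists>d\<le>c. (g has_real_derivative d) (at t within {a..b})"
  shows "g b - g a \<le> c * (b - a)"
proof (rule field_le_epsilon)
  fix e :: real assume "e > 0"
  define \<eta> where "\<eta> = e / (2 * (\<bar>K\<bar> + \<bar>c\<bar> + 1))"
  define \<kappa> where "\<kappa> = e / (2 * (b - a + 1))"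
  have \<eta>: "\<eta> > 0" and \<kappa>: "\<kappa> > 0" using \<open>e > 0\<close> ab by (auto simp: \<eta>_def \<kappa>_def)
  obtain \<delta>0 where "\<delta>0 > 0" and \<delta>0: "\<And>D. D division_of \<Union>D \<Longrightarrow> \<Union>D \<subseteq> {a..b} \<Longrightarrow>
      (\<Sum>J\<in>D. Sup J - Inf J) < \<delta>0 \<Longrightarrow> (\<Sum>J\<in>D. norm (\<gamma> (Sup J) - \<gamma> (Inf J))) < \<eta>"
    using ac \<eta> unfolding absolutely_continuous_on_def by meson
  define \<delta> where "\<delta> = min \<delta>0 \<eta>"
  have "\<delta> > 0" using \<open>\<delta>0 > 0\<close> \<eta> by (simp add: \<delta>_def)
  have "N \<in> null_sets lebesgue"
    using N by (simp add: negligible_iff_null_sets)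
  then obtain U where U: "open U" "N \<subseteq> U" "U - N \<in> lmeasurable"
      "emeasure lebesgue (U - N) < ennreal \<delta>"
    using sets_lebesgue_outer_open[of N \<delta>] \<open>\<delta> > 0\<close> by auto
  moreover have "emeasure lebesgue (U - N) = emeasure lebesgue U"
    using \<open>N \<in> null_sets lebesgue\<close> \<open>open U\<close> by (intro emeasure_Diff_null_set) auto
  ultimately have "emeasure lebesgue U < ennreal \<delta>" by simp
  moreover from this have "U \<in> lmeasurable"
    using \<open>open U\<close> by (intro fmeasurableI) (auto intro: order_less_trans)
  ultimately have U': "U \<in> lmeasurable" "measure lebesgue U < \<delta>"
    using \<open>\<delta> > 0\<close> by (auto simp: emeasure_eq_measure2 ennreal_less_iff)
  have "\<exists>r>0. \<forall>u v. u \<in> {a..b} \<longrightarrow> v \<in> {a..b} \<longrightarrow> u \<le> t \<longrightarrow> t \<le> v \<longrightarrow> {u..v} \<subseteq> ball t r \<longrightarrow>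
          g v - g u \<le> (c + \<kappa>) * (v - u)" if t: "t \<in> {a..b} - N" for t
  proof -
    obtain d where "d \<le> c" and d: "(g has_real_derivative d) (at t within {a..b})"
      using der[OF t] by blast
    then obtain r where "r > 0" and r: "\<And>y. y \<in> {a..b} \<Longrightarrow> \<bar>y - t\<bar> < r \<Longrightarrow>
        \<bar>g y - g t - d * (y - t)\<bar> \<le> \<kappa> * \<bar>y - t\<bar>"
      using \<kappa> unfolding has_field_derivative_def has_derivative_within_alt real_norm_def by metis
    have "g v - g u \<le> (c + \<kappa>) * (v - u)"
      if "u \<in> {a..b}" "v \<in> {a..b}" "u \<le> t" "t \<le> v" "{u..v} \<subseteq> ball t r" for u v
    proof -
      have "u \<in> ball t r" "v \<in> ball t r" using that by (auto simp del: mem_ball intro!: subsetD[OF that(5)])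
      then have "\<bar>g u - g t - d * (u - t)\<bar> \<le> \<kappa> * \<bar>u - t\<bar>"
        "\<bar>g v - g t - d * (v - t)\<bar> \<le> \<kappa> * \<bar>v - t\<bar>"
        using r[of u] r[of v] that by (simp_all add: dist_real_def abs_minus_commute)
      then have "g v - g u \<le> (d + \<kappa>) * (v - u)"
        using that by (simp add: algebra_simps abs_le_iff)
      also have "\<dots> \<le> (c + \<kappa>) * (v - u)"
        using \<open>d \<le> c\<close> that by (intro mult_right_mono) auto
      finally show ?thesis .
    qed
    then show ?thesis using \<open>r > 0\<close> by blast
  qed
  then obtain r where r: "\<And>t. t \<in> {a..b} - N \<Longrightarrow> r t > 0"
    "\<And>t u v. t \<in> {a..b} - N \<Longrightarrow> u \<in> {a..b} \<Longrightarrow> v \<in> {a..b} \<Longrightarrow> u \<le> t \<Longrightarrow> t \<le> v \<Longrightarrow>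
        {u..v} \<subseteq> ball t (r t) \<Longrightarrow> g v - g u \<le> (c + \<kappa>) * (v - u)"
    by metis
  define G where "G t = (if t \<in> N then U else if t \<in> {a..b} then ball t (r t) else UNIV)" for t
  have "gauge G"
    using U r(1) by (auto simp: gauge_def G_def)
  then obtain p where p: "p tagged_division_of {a..b}" and fine: "G fine p"
    by (rule fine_division_exists_real)
  note pD = tagged_division_ofD[OF p]
  have box: "\<exists>u v. J = {u..v} \<and> u \<le> t \<and> t \<le> v \<and> u \<in> {a..b} \<and> v \<in> {a..b}" if "(t, J) \<in> p" for t J
    using pD(2,3,4)[OF that] by (auto simp: box_real)
  define q where "q = {tJ \<in> p. fst tJ \<in> N}"
  have "q \<subseteq> p" by (auto simp: q_def)
  have fin: "finite p" "finite q" using pD(1) by (auto simp: q_def)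
  have boxq: "\<exists>u v. J = {u..v} \<and> u \<le> v \<and> a \<le> u \<and> v \<le> b" if "(t, J) \<in> q" for t J
    using box[of t J] that \<open>q \<subseteq> p\<close> by (meson order_trans atLeastAtMost_iff subsetD)
  have "p tagged_partial_division_of {a..b}"
    using p by (simp add: tagged_division_of_def)
  then have "q tagged_partial_division_of {a..b}"
    using \<open>q \<subseteq> p\<close> tagged_partial_division_subset by blast
  then have qtag: "q tagged_division_of \<Union>(snd ` q)"
    by (rule tagged_partial_division_of_Union_self)
  then have qdiv: "snd ` q division_of \<Union>(snd ` q)"
    by (rule division_of_tagged_division)
  have sumq: "(\<Sum>(t,J)\<in>q. \<phi> J) = (\<Sum>J\<in>snd ` q. \<phi> J)" if "\<And>t. \<phi> {t} = 0" for \<phi> :: "real set \<Rightarrow> real"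
  proof -
    \<comment> \<open>The lemma on sums over tagged divisions also wants the value 0 at the empty set, where \<open>Sup\<close> and \<open>Inf\<close> are arbitrary.\<close>
    define \<psi> where "\<psi> J = (if J = {} then 0 else \<phi> J)" for J
    have ne: "J \<noteq> {}" if "(t, J) \<in> q" for t J using pD(2) that \<open>q \<subseteq> p\<close> by blast
    have "(\<Sum>(t,J)\<in>q. \<phi> J) = (\<Sum>(t,J)\<in>q. \<psi> J)"
      using ne by (intro sum.cong) (auto simp: \<psi>_def)
    also have "\<dots> = (\<Sum>J\<in>snd ` q. \<psi> J)"
    proof (rule sum.over_tagged_division_lemma[OF qtag])
      fix u v :: real assume "box u v = {}"
      then have "cbox u v = {} \<or> cbox u v = {u}" by (auto simp: box_real)
      then show "\<psi> (cbox u v) = 0" using that by (auto simp: \<psi>_def)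
    qed
    also have "\<dots> = (\<Sum>J\<in>snd ` q. \<phi> J)"
      using ne by (intro sum.cong) (auto simp: \<psi>_def)
    finally show ?thesis .
  qed
  have len: "(\<Sum>J\<in>snd ` q. Sup J - Inf J) < \<delta>"
  proof -
    have "(\<Sum>J\<in>snd ` q. Sup J - Inf J) = (\<Sum>J\<in>snd ` q. measure lebesgue J)"
    proof (rule sum.cong)
      fix J assume "J \<in> snd ` q"
      then obtain u v where "J = {u..v}" "u \<le> v"
        using boxq by (metis imageE prod.collapse)
      then show "Sup J - Inf J = measure lebesgue J" by simp
    qed simp
    also have "\<dots> = measure lebesgue (\<Union>(snd ` q))"
    proof (rule measure_negligible_finite_Union[symmetric])
      show "finite (snd ` q)" using fin by simp
      show "J \<in> lmeasurable" if "J \<in> snd ` q" for J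
        using division_ofD(4)[OF qdiv that] by auto
      show "pairwise (\<lambda>J J'. negligible (J \<inter> J')) (snd ` q)"
      proof (rule pairwiseI)
        fix J J' assume J: "J \<in> snd ` q" "J' \<in> snd ` q" "J \<noteq> J'"
        have "convex J" "convex J'"
          using division_ofD(4)[OF qdiv] J by (metis convex_box(1))+
        moreover have "interior (J \<inter> J') = {}"
          using division_ofD(5)[OF qdiv J] by simp
        ultimately show "negligible (J \<inter> J')"
          by (simp add: negligible_convex_interior convex_Int)
      qed
    qed
    also have "\<dots> \<le> measure lebesgue U"
    proof (rule measure_mono_fmeasurable)
      show "\<Union>(snd ` q) \<subseteq> U"
      proof clarify
        fix s t J assume "s \<in> snd (t, J)" "(t, J) \<in> q"
        then have "s \<in> G t" "t \<in> N" using fine by (auto simp: q_def fine_def)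
        then show "s \<in> U" by (simp add: G_def)
      qed
      show "\<Union>(snd ` q) \<in> sets lebesgue"
      proof (rule sets.finite_Union)
        show "snd ` q \<subseteq> sets lebesgue" using division_ofD(4)[OF qdiv] by fastforce
      qed (use fin in simp)
    qed (use U' in simp)
    finally show ?thesis using U' by simp
  qed
  have bad: "(\<Sum>(t,J)\<in>q. g (Sup J) - g (Inf J)) \<le> \<bar>K\<bar> * \<eta>"
  proof -
    have "(\<Sum>(t,J)\<in>q. g (Sup J) - g (Inf J)) \<le> (\<Sum>(t,J)\<in>q. \<bar>K\<bar> * norm (\<gamma> (Sup J) - \<gamma> (Inf J)))"
    proof (intro sum_mono, clarify)
      fix t J assume "(t, J) \<in> q"
      then obtain u v where "J = {u..v}" "u \<le> v" "a \<le> u" "v \<le> b"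
        using boxq by blast
      then have "g (Sup J) - g (Inf J) \<le> K * norm (\<gamma> (Sup J) - \<gamma> (Inf J))"
        using dom by simp
      also have "\<dots> \<le> \<bar>K\<bar> * norm (\<gamma> (Sup J) - \<gamma> (Inf J))"
        by (intro mult_right_mono) auto
      finally show "g (Sup J) - g (Inf J) \<le> \<bar>K\<bar> * norm (\<gamma> (Sup J) - \<gamma> (Inf J))" .
    qed
    also have "\<dots> = \<bar>K\<bar> * (\<Sum>J\<in>snd ` q. norm (\<gamma> (Sup J) - \<gamma> (Inf J)))"
      by (subst sumq) (auto simp: sum_distrib_left)
    also have "\<dots> \<le> \<bar>K\<bar> * \<eta>"
    proof (rule mult_left_mono[OF less_imp_le[OF \<delta>0[OF qdiv]]])
      show "\<Union>(snd ` q) \<subseteq> {a..b}" using pD(3) \<open>q \<subseteq> p\<close> by fastforce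
      show "(\<Sum>J\<in>snd ` q. Sup J - Inf J) < \<delta>0" using len by (simp add: \<delta>_def)
    qed auto
    finally show ?thesis .
  qed
  have qlen: "0 \<le> (\<Sum>(t,J)\<in>q. Sup J - Inf J)" "(\<Sum>(t,J)\<in>q. Sup J - Inf J) \<le> \<eta>"
  proof -
    show "0 \<le> (\<Sum>(t,J)\<in>q. Sup J - Inf J)"
    proof (intro sum_nonneg, clarify)
      fix t J assume "(t, J) \<in> q"
      then obtain u v where "J = {u..v}" "u \<le> v" using boxq by blast
      then show "0 \<le> Sup J - Inf J" by simp
    qed
    show "(\<Sum>(t,J)\<in>q. Sup J - Inf J) \<le> \<eta>"
      using len by (subst sumq) (auto simp: \<delta>_def)
  qed
  have good: "(\<Sum>(t,J)\<in>p - q. g (Sup J) - g (Inf J)) \<le> (\<Sum>(t,J)\<in>p - q. (c + \<kappa>) * (Sup J - Inf J))"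
  proof (intro sum_mono, clarify)
    fix t J assume tJ: "(t, J) \<in> p" "(t, J) \<notin> q"
    then obtain u v where uv: "J = {u..v}" "u \<le> t" "t \<le> v" "u \<in> {a..b}" "v \<in> {a..b}"
      using box by blast
    have "t \<notin> N" using tJ by (auto simp: q_def)
    moreover have "t \<in> {a..b}" using uv by auto
    moreover have "J \<subseteq> G t" using fine tJ(1) by (auto simp: fine_def)
    ultimately have "g v - g u \<le> (c + \<kappa>) * (v - u)"
      using r(2)[of t u v] uv by (auto simp: G_def)
    then show "g (Sup J) - g (Inf J) \<le> (c + \<kappa>) * (Sup J - Inf J)"
      using uv by simp
  qed
  have split: "(\<Sum>(t,J)\<in>p. \<phi> J) = (\<Sum>(t,J)\<in>p - q. \<phi> J) + (\<Sum>(t,J)\<in>q. \<phi> J)" for \<phi> :: "real set \<Rightarrow> real"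
    using sum.subset_diff[OF \<open>q \<subseteq> p\<close> fin(1)] by blast
  have "g b - g a = (\<Sum>(t,J)\<in>p. g (Sup J) - g (Inf J))"
    by (rule additive_tagged_division_1[OF ab p, symmetric])
  also have "\<dots> \<le> (\<Sum>(t,J)\<in>p - q. (c + \<kappa>) * (Sup J - Inf J)) + \<bar>K\<bar> * \<eta>"
    using good bad by (subst split) simp
  also have "(\<Sum>(t,J)\<in>p - q. (c + \<kappa>) * (Sup J - Inf J))
      = (c + \<kappa>) * ((b - a) - (\<Sum>(t,J)\<in>q. Sup J - Inf J))"
  proof -
    have "(\<Sum>(t,J)\<in>p - q. Sup J - Inf J) = (b - a) - (\<Sum>(t,J)\<in>q. Sup J - Inf J)"
      using split[of "\<lambda>J. Sup J - Inf J"] additive_tagged_division_1[OF ab p, of "\<lambda>x. x"] by simp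
    moreover have "(\<Sum>(t,J)\<in>p - q. (c + \<kappa>) * (Sup J - Inf J))
        = (c + \<kappa>) * (\<Sum>(t,J)\<in>p - q. Sup J - Inf J)"
      by (simp only: sum_distrib_left case_prod_unfold)
    ultimately show ?thesis by simp
  qed
  also have "\<dots> + \<bar>K\<bar> * \<eta> \<le> c * (b - a) + \<kappa> * (b - a) + (\<bar>c\<bar> + \<bar>K\<bar>) * \<eta>"
  proof -
    define s where "s = (\<Sum>(t,J)\<in>q. Sup J - Inf J)"
    have s: "0 \<le> s" "s \<le> \<eta>" using qlen by (auto simp: s_def)
    have "- c * s \<le> \<bar>c\<bar> * \<eta>" using s by (intro order_trans[OF mult_right_mono[of "-c" "\<bar>c\<bar>"]] mult_left_mono) auto
    moreover have "0 \<le> \<kappa> * s" using s \<kappa> by simp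
    ultimately show ?thesis unfolding s_def[symmetric] by (simp add: algebra_simps)
  qed
  also have "\<kappa> * (b - a) \<le> e / 2"
    using ab \<open>e > 0\<close> by (simp add: \<kappa>_def field_simps)
  also have "(\<bar>c\<bar> + \<bar>K\<bar>) * \<eta> \<le> e / 2"
    using \<open>e > 0\<close> by (simp add: \<eta>_def field_simps add_nonneg_pos)
  finally show "g b - g a \<le> c * (b - a) + e" by simp
qed

lemma absolutely_continuous_on_subset:
  assumes "absolutely_continuous_on J \<gamma>" "I \<subseteq> J"
  shows "absolutely_continuous_on I \<gamma>"
  using assms unfolding absolutely_continuous_on_def by (meson order_trans)

lemma absolutely_continuous_imp_continuous_on:
  fixes \<gamma> :: "real \<Rightarrow> 'a::real_normed_vector"
  assumes ac: "absolutely_continuous_on {a..b} \<gamma>"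
  shows "continuous_on {a..b} \<gamma>"
proof (unfold continuous_on_iff, intro ballI allI impI)
  fix t and e :: real assume t: "t \<in> {a..b}" and "e > 0"
  then obtain d where "d > 0" and d: "\<And>D. D division_of \<Union>D \<Longrightarrow> \<Union>D \<subseteq> {a..b} \<Longrightarrow>
      (\<Sum>J\<in>D. Sup J - Inf J) < d \<Longrightarrow> (\<Sum>J\<in>D. norm (\<gamma> (Sup J) - \<gamma> (Inf J))) < e"
    using ac unfolding absolutely_continuous_on_def by meson
  have *: "norm (\<gamma> v - \<gamma> u) < e" if "u \<le> v" "a \<le> u" "v \<le> b" "v - u < d" for u v
  proof -
    have "{{u..v}} division_of \<Union>{{u..v}}"
      using division_of_self[of u v] that by (simp add: box_real)
    from d[OF this] show ?thesis using that by simp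
  qed
  have "dist (\<gamma> s) (\<gamma> t) < e" if "s \<in> {a..b}" "dist s t < d" for s
    using *[of s t] *[of t s] that t
    by (cases "s \<le> t") (auto simp: dist_norm norm_minus_commute)
  then show "\<exists>d>0. \<forall>s\<in>{a..b}. dist s t < d \<longrightarrow> dist (\<gamma> s) (\<gamma> t) < e"
    using \<open>d > 0\<close> by blast
qed

text \<open>
Chain rule for a differentiable observable \<open>\<phi>\<close> along a solution of a differential inclusion, in the
form of a comparison principle: a bound on the derivative for every admissible velocity bounds the
increment.
\<close>
lemma trajectory_increment_le:
  fixes \<gamma> :: "real \<Rightarrow> 'a::euclidean_space" and \<phi> :: "'a \<Rightarrow> real"
  assumes traj: "trajectory F \<gamma>" and ab: "0 \<le> a" "a \<le> b"
    and dom: "\<And>u v. a \<le> u \<Longrightarrow> u \<le> v \<Longrightarrow> v \<le> b \<Longrightarrow> \<phi> (\<gamma> v) - \<phi> (\<gamma> u) \<le> K * norm (\<gamma> v - \<gamma> u)"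
    and \<phi>: "\<And>p. (\<phi> has_derivative (\<phi>' p)) (at p)"
    and le: "\<And>t v. a \<le> t \<Longrightarrow> t \<le> b \<Longrightarrow> v \<in> F (\<gamma> t) \<Longrightarrow> \<phi>' (\<gamma> t) v \<le> c"
  shows "\<phi> (\<gamma> b) - \<phi> (\<gamma> a) \<le> c * (b - a)"
proof -
  have "AE t in lebesgue. 0 \<le> t \<longrightarrow> (\<exists>v\<in>F (\<gamma> t). (\<gamma> has_vector_derivative v) (at t within {0..}))"
    using traj by (simp add: trajectory_def)
  then obtain N where N: "N \<in> null_sets lebesgue"
    "\<And>t. t \<notin> N \<Longrightarrow> 0 \<le> t \<Longrightarrow> \<exists>v\<in>F (\<gamma> t). (\<gamma> has_vector_derivative v) (at t within {0..})"
    unfolding eventually_ae_filter by auto blast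
  show ?thesis
  proof (rule absolutely_continuous_increment_le[where g="\<lambda>t. \<phi> (\<gamma> t)" and N=N and \<gamma>=\<gamma>])
    have "absolutely_continuous_on {0..b+1} \<gamma>"
      using traj ab by (simp add: trajectory_def)
    then show "absolutely_continuous_on {a..b} \<gamma>"
      by (rule absolutely_continuous_on_subset) (use ab in auto)
    show "negligible N" using N(1) by (simp add: negligible_iff_null_sets)
    fix t assume t: "t \<in> {a..b} - N"
    then obtain v where v: "v \<in> F (\<gamma> t)" "(\<gamma> has_vector_derivative v) (at t within {0..})"
      using N(2)[of t] ab by auto
    have "(\<gamma> has_vector_derivative v) (at t within {a..b})"
      by (rule has_vector_derivative_within_subset[OF v(2)]) (use ab in auto)
    then have "((\<phi> \<circ> \<gamma>) has_derivative (\<phi>' (\<gamma> t) \<circ> (\<lambda>h. h *\<^sub>R v))) (at t within {a..b})"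
      unfolding has_vector_derivative_def
      by (rule diff_chain_within) (rule has_derivative_at_withinI[OF \<phi>])
    moreover have "linear (\<phi>' (\<gamma> t))" using \<phi> by (rule has_derivative_linear)
    ultimately have "((\<lambda>t. \<phi> (\<gamma> t)) has_real_derivative (\<phi>' (\<gamma> t) v)) (at t within {a..b})"
      by (simp add: has_field_derivative_def comp_def linear_scale mult_commute_abs)
    then show "\<exists>d\<le>c. ((\<lambda>t. \<phi> (\<gamma> t)) has_real_derivative d) (at t within {a..b})"
      using le t v(1) by (meson DiffD1 atLeastAtMost_iff)
  qed (use ab dom in auto)
qed

section \<open>Lagrange multipliers and subgradients of convex functions\<close>

text \<open>
The multiplier is the normal of a hyperplane that separates the origin from the convex set of pairs
\<open>(L x, r)\<close> with \<open>g x < g x0 + r\<close>; it misses the origin because \<open>x0\<close> is a constrained minimizer. Taking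
the normal inside the span of that set puts its first component into the range of \<open>L\<close>, which excludes
the degenerate case of a vertical hyperplane: there \<open>q\<close> would lie both in the range and in the kernel
of the symmetric map \<open>L\<close>. For \<open>L\<close> the identity the multiplier is minus a subgradient.
\<close>
lemma convex_lagrange_multiplier:
  fixes g :: "'a::euclidean_space \<Rightarrow> real" and L :: "'a \<Rightarrow> 'a"
  assumes conv: "convex_on UNIV g" and L: "linear L" and sym: "\<And>x y. L x \<bullet> y = x \<bullet> L y"
    and min: "\<And>y. L y = 0 \<Longrightarrow> g x0 \<le> g y"
  obtains z where "\<And>x. 0 \<le> g x - g x0 + z \<bullet> L x"
proof -
  interpret L: linear L by fact
  define C where "C = {(L x, r) | x r. g x < g x0 + r}"
  have "convex C"
  proof (rule convexI)
    fix p q and u v :: real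
    assume "p \<in> C" "q \<in> C" and uv: "0 \<le> u" "0 \<le> v" "u + v = 1"
    then obtain x r y s where pq: "p = (L x, r)" "g x < g x0 + r" "q = (L y, s)" "g y < g x0 + s"
      by (auto simp: C_def)
    have "g (u *\<^sub>R x + v *\<^sub>R y) \<le> u * g x + v * g y"
      using conv uv by (auto simp: convex_on_def)
    also have "\<dots> < u * (g x0 + r) + v * (g x0 + s)"
    proof (cases "u = 0")
      case True then show ?thesis using pq uv by simp
    next
      case False
      then show ?thesis using pq uv
        by (intro add_less_le_mono mult_strict_left_mono mult_left_mono) auto
    qed
    also have "\<dots> = g x0 + (u * r + v * s)"
      using uv(3) by (simp add: algebra_simps flip: distrib_right)
    finally have "(L (u *\<^sub>R x + v *\<^sub>R y), u * r + v * s) \<in> C"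
      by (auto simp: C_def)
    then show "u *\<^sub>R p + v *\<^sub>R q \<in> C"
      by (simp add: pq L.add L.scaleR)
  qed
  moreover have "(L x0, 1) \<in> C" by (force simp: C_def)
  then have "C \<noteq> {}" by blast
  moreover have "0 \<notin> C"
    using min by (force simp: C_def zero_prod_def)
  ultimately obtain p where p: "p \<in> span C" "p \<noteq> 0" "\<And>w. w \<in> C \<Longrightarrow> 0 \<le> p \<bullet> w"
    using separating_hyperplane_set_0_inspan by blast
  obtain q \<alpha> where pq: "p = (q, \<alpha>)" by fastforce
  have ineq: "0 \<le> q \<bullet> L x + \<alpha> * r" if "g x < g x0 + r" for x r
    using p(3)[of "(L x, r)"] that by (auto simp: C_def pq)
  have "span C \<subseteq> range L \<times> UNIV"
  proof (rule span_minimal)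
    show "C \<subseteq> range L \<times> UNIV" by (auto simp: C_def)
    show "subspace (range L \<times> (UNIV :: real set))"
      by (intro subspace_Times linear_subspace_image[OF L]) auto
  qed
  then obtain y where y: "q = L y" using p(1) pq by auto
  have "0 \<le> \<alpha>"
  proof (rule ccontr)
    assume "\<not> 0 \<le> \<alpha>"
    then have "\<alpha> < 0" by simp
    define r where "r = 1 + \<bar>q \<bullet> L x0\<bar> / (- \<alpha>)"
    have "r > 0" using \<open>\<alpha> < 0\<close> by (auto simp: r_def intro!: add_pos_nonneg divide_nonneg_neg)
    then have "0 \<le> q \<bullet> L x0 + \<alpha> * r" by (intro ineq) auto
    moreover have "\<alpha> * r = \<alpha> - \<bar>q \<bullet> L x0\<bar>"
      using \<open>\<alpha> < 0\<close> by (simp add: r_def field_simps)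
    ultimately show False using \<open>\<alpha> < 0\<close> by linarith
  qed
  moreover have "\<alpha> \<noteq> 0"
  proof
    assume "\<alpha> = 0"
    then have "0 \<le> q \<bullet> L x" for x
      using ineq[of x "g x - g x0 + 1"] by simp
    then have "0 \<le> L q \<bullet> x" for x by (simp add: sym)
    from this[of "- L q"] have "L q = 0"
      by (metis inner_eq_zero_iff inner_ge_zero inner_minus_right neg_0_le_iff_le order_antisym)
    then have "q \<bullet> q = 0" using sym[of q y] y by simp
    then show False using p(2) pq \<open>\<alpha> = 0\<close> by (simp add: zero_prod_def)
  qed
  ultimately have "\<alpha> > 0" by simp
  have "0 \<le> g x - g x0 + (q /\<^sub>R \<alpha>) \<bullet> L x" for x
  proof (rule field_le_epsilon)
    fix e :: real assume "e > 0"
    have "0 \<le> q \<bullet> L x + \<alpha> * (g x - g x0 + e)"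
      by (rule ineq) (use \<open>e > 0\<close> in auto)
    also have "\<dots> = \<alpha> * ((g x - g x0 + (q /\<^sub>R \<alpha>) \<bullet> L x) + e)"
      using \<open>\<alpha> > 0\<close> by (simp add: field_simps)
    finally show "0 \<le> g x - g x0 + (q /\<^sub>R \<alpha>) \<bullet> L x + e"
      using \<open>\<alpha> > 0\<close> by (simp add: zero_le_mult_iff)
  qed
  then show ?thesis using that by blast
qed

lemma convex_on_translate:
  fixes g :: "'a::euclidean_space \<Rightarrow> real"
  assumes "convex_on UNIV g"
  shows "convex_on UNIV (\<lambda>h. g (a + h))"
proof (rule convex_onI)
  fix t :: real and x y :: 'a assume "0 < t" "t < 1"
  moreover have "a + ((1 - t) *\<^sub>R x + t *\<^sub>R y) = (1 - t) *\<^sub>R (a + x) + t *\<^sub>R (a + y)"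
    by (simp add: algebra_simps)
  ultimately show "g (a + ((1 - t) *\<^sub>R x + t *\<^sub>R y)) \<le> (1 - t) * g (a + x) + t * g (a + y)"
    using convex_onD[OF assms, of t "a + x" "a + y"] by simp
qed auto

lemma convex_subgradient_exists:
  fixes g :: "'a::euclidean_space \<Rightarrow> real"
  assumes "convex_on UNIV g"
  obtains p where "\<And>y. g x + p \<bullet> (y - x) \<le> g y"
proof -
  obtain z where z: "\<And>h. 0 \<le> g (x + h) - g (x + 0) + z \<bullet> h"
  proof (rule convex_lagrange_multiplier[of "\<lambda>h. g (x + h)" "\<lambda>h. h" 0])
    show "convex_on UNIV (\<lambda>h. g (x + h))"
      by (rule convex_on_translate[OF assms])
  qed (auto simp: linear_ident)
  have "g x + (- z) \<bullet> (y - x) \<le> g y" for y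
    using z[of "y - x"] by simp
  then show ?thesis using that by blast
qed

lemma gradient_eqI:
  assumes "GDERIV g x :> D"
  shows "gradient g x = D"
  unfolding gradient_def
proof (rule the_equality)
  show "GDERIV g x :> D" by fact
next
  fix D' assume "GDERIV g x :> D'"
  then have "(\<lambda>h. h \<bullet> D') = (\<lambda>h. h \<bullet> D)"
    using assms has_derivative_unique unfolding gderiv_def by blast
  then show "D' = D" by (metis vector_eq_ldot inner_commute)
qed

text \<open>
At a point of differentiability any subgradient \<open>p\<close> equals the gradient, because \<open>g\<close> minus its affine
minorant with slope \<open>p\<close> attains its minimum there.
\<close>
lemma convex_gradient_subgradient:
  fixes g :: "'a::euclidean_space \<Rightarrow> real"
  assumes conv: "convex_on UNIV g" and "g differentiable (at x)"
  shows "g x + gradient g x \<bullet> (y - x) \<le> g y"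
proof -
  obtain g' where g': "(g has_derivative g') (at x)"
    using assms(2) by (auto simp: differentiable_def)
  obtain p where p: "\<And>y. g x + p \<bullet> (y - x) \<le> g y"
    using convex_subgradient_exists[OF conv] by blast
  have "((\<lambda>y. g y - p \<bullet> (y - x)) has_derivative (\<lambda>h. g' h - p \<bullet> h)) (at x)"
    by (auto intro!: derivative_eq_intros g')
  then have "(\<lambda>h. g' h - p \<bullet> h) = (\<lambda>h. 0)"
  proof (rule differential_zero_maxmin[of x UNIV, rotated 2])
    show "(\<forall>y\<in>UNIV. g y - p \<bullet> (y - x) \<le> g x - p \<bullet> (x - x)) \<or>
          (\<forall>y\<in>UNIV. g x - p \<bullet> (x - x) \<le> g y - p \<bullet> (y - x))"
      using p by (auto simp: algebra_simps)
  qed auto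
  then have "g' = (\<lambda>h. h \<bullet> p)" by (metis eq_iff_diff_eq_0 inner_commute)
  then have "GDERIV g x :> p" using g' by (simp add: gderiv_def)
  then show ?thesis using p gradient_eqI by metis
qed

text \<open>
The subgradient inequality survives limits of gradients, by continuity of \<open>g\<close>, and convex
combinations. So Clarke's generalized gradient consists of subgradients.
\<close>
lemma limit_gradient_subgradient:
  fixes g :: "'a::euclidean_space \<Rightarrow> real"
  assumes conv: "convex_on UNIV g" and v: "v \<in> generalized_gradient S g x"
  shows "g x + v \<bullet> (y - x) \<le> g y"
proof -
  have cont: "continuous_on UNIV g"
    using conv by (simp add: convex_on_continuous)
  define H where "H = {v. \<forall>y. g x + v \<bullet> (y - x) \<le> g y}"
  have "convex H"
  proof (rule convexI)
    fix p q and a b :: real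
    assume pq: "p \<in> H" "q \<in> H" and ab: "0 \<le> a" "0 \<le> b" "a + b = 1"
    have "g x + (a *\<^sub>R p + b *\<^sub>R q) \<bullet> (y - x) \<le> g y" for y
    proof -
      have "a * (g x + p \<bullet> (y - x)) + b * (g x + q \<bullet> (y - x)) \<le> a * g y + b * g y"
        using pq ab by (intro add_mono mult_left_mono) (auto simp: H_def)
      moreover have "a * (g x + p \<bullet> (y - x)) + b * (g x + q \<bullet> (y - x)) =
          (a + b) * g x + (a *\<^sub>R p + b *\<^sub>R q) \<bullet> (y - x)"
        by (simp add: inner_add_left distrib_left distrib_right)
      moreover have "a * g y + b * g y = g y"
        using ab(3) by (metis distrib_right mult_1)
      ultimately show ?thesis using ab(3) by simp
    qed
    then show "a *\<^sub>R p + b *\<^sub>R q \<in> H" by (simp add: H_def)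
  qed
  moreover have "{v. \<exists>\<xi>. \<xi> \<longlonglongrightarrow> x \<and> (\<forall>k. \<xi> k \<notin> nondifferentiability_set g \<union> S) \<and>
                         (\<lambda>k. gradient g (\<xi> k)) \<longlonglongrightarrow> v} \<subseteq> H"
  proof clarify
    fix w \<xi> assume \<xi>: "\<xi> \<longlonglongrightarrow> x" "\<forall>k. \<xi> k \<notin> nondifferentiability_set g \<union> S"
      "(\<lambda>k. gradient g (\<xi> k)) \<longlonglongrightarrow> w"
    have "g x + w \<bullet> (y - x) \<le> g y" for y
    proof (rule LIMSEQ_le_const2)
      show "(\<lambda>k. g (\<xi> k) + gradient g (\<xi> k) \<bullet> (y - \<xi> k)) \<longlonglongrightarrow> g x + w \<bullet> (y - x)"
        using \<xi> continuous_on_tendsto_compose[OF cont \<xi>(1)] by (intro tendsto_intros) auto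
      show "\<exists>N. \<forall>k\<ge>N. g (\<xi> k) + gradient g (\<xi> k) \<bullet> (y - \<xi> k) \<le> g y"
        using \<xi>(2) convex_gradient_subgradient[OF conv]
        by (auto simp: nondifferentiability_set_def)
    qed
    then show "w \<in> H" by (simp add: H_def)
  qed
  ultimately have "generalized_gradient S g x \<subseteq> H"
    unfolding generalized_gradient_def by (intro hull_minimal) auto
  then show ?thesis using v by (auto simp: H_def)
qed

text \<open>
A long subgradient at \<open>x\<close> would force a large increase of \<open>g\<close> within distance 1 of \<open>x\<close>, but \<open>g\<close> is
bounded on the ball of radius \<open>R + 1\<close>.
\<close>
lemma subgradients_bounded_on_cball:
  fixes g :: "'a::euclidean_space \<Rightarrow> real"
  assumes conv: "convex_on UNIV g"
  obtains B where "B > 0"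
    "\<And>x v. norm x \<le> R \<Longrightarrow> (\<And>y. g x + v \<bullet> (y - x) \<le> g y) \<Longrightarrow> norm v \<le> B"
proof -
  have "continuous_on (cball 0 (R + 1)) g"
    using convex_on_continuous[OF open_UNIV conv] continuous_on_subset by blast
  then have "bounded (g ` cball 0 (R + 1))"
    by (intro compact_imp_bounded compact_continuous_image) auto
  then obtain M where "M > 0" and M: "\<And>x. norm x \<le> R + 1 \<Longrightarrow> \<bar>g x\<bar> \<le> M"
    by (auto simp: bounded_pos)
  have "norm v \<le> 2 * M" if x: "norm x \<le> R" and v: "\<And>y. g x + v \<bullet> (y - x) \<le> g y" for x v
  proof (cases "v = 0")
    case False
    have "norm (x + v /\<^sub>R norm v) \<le> R + 1"
      using x False by (intro norm_triangle_le) auto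
    then have "\<bar>g (x + v /\<^sub>R norm v)\<bar> \<le> M" "\<bar>g x\<bar> \<le> M" using M x by auto
    moreover have "g x + norm v \<le> g (x + v /\<^sub>R norm v)"
      using v[of "x + v /\<^sub>R norm v"] False
      by (simp add: dot_square_norm power2_eq_square mult.assoc[symmetric])
    ultimately show ?thesis by linarith
  qed (use \<open>M > 0\<close> in auto)
  then show ?thesis using that[of "2 * M"] \<open>M > 0\<close> by auto
qed

section \<open>Differentiability almost everywhere and critical points of convex functions\<close>

text \<open>
A selection of subgradients of \<open>\<phi>\<close> is monotone, and the symmetric second difference with step \<open>h\<close>
at \<open>t\<close> is at most \<open>h\<close> times the increment of the selection from \<open>t - h\<close> to \<open>t + h\<close>. So a kink of
size \<open>c\<close> is a discontinuity of a monotone function.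
\<close>
lemma countable_kinks:
  fixes \<phi> :: "real \<Rightarrow> real"
  assumes conv: "convex_on UNIV \<phi>" and "c > 0"
  shows "countable {t. \<forall>h\<in>{0<..1}. c * h \<le> \<phi> (t + h) + \<phi> (t - h) - 2 * \<phi> t}"
proof -
  have "\<exists>p. \<forall>u. \<phi> t + p * (u - t) \<le> \<phi> u" for t
    using convex_subgradient_exists[OF conv, of t] by (metis inner_real_def)
  then obtain s where s: "\<And>t u. \<phi> t + s t * (u - t) \<le> \<phi> u" by metis
  have "mono s"
  proof (rule monoI)
    fix t u :: real assume "t \<le> u"
    show "s t \<le> s u"
    proof (cases "t = u")
      case False
      have "(s t - s u) * (u - t) \<le> 0"
        using s[of t u] s[of u t] by (simp add: algebra_simps)
      then show ?thesis using False \<open>t \<le> u\<close> by (simp add: mult_le_0_iff)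
    qed simp
  qed
  moreover have "{t. \<forall>h\<in>{0<..1}. c * h \<le> \<phi> (t + h) + \<phi> (t - h) - 2 * \<phi> t} \<subseteq> {t. \<not> isCont s t}"
  proof clarify
    fix t assume t: "\<forall>h\<in>{0<..1}. c * h \<le> \<phi> (t + h) + \<phi> (t - h) - 2 * \<phi> t" and "isCont s t"
    then obtain d where "d > 0" and d: "\<And>u. \<bar>u - t\<bar> < d \<Longrightarrow> \<bar>s u - s t\<bar> < c / 2"
      using \<open>c > 0\<close> unfolding continuous_at_eps_delta dist_real_def by (metis half_gt_zero)
    define h where "h = min 1 (d / 2)"
    have h: "0 < h" "h \<le> 1" "h < d" using \<open>d > 0\<close> by (auto simp: h_def)
    have "\<phi> (t + h) + \<phi> (t - h) - 2 * \<phi> t \<le> (s (t + h) - s (t - h)) * h"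
      using s[of "t + h" t] s[of "t - h" t] by (simp add: algebra_simps)
    also have "\<dots> < c * h"
    proof (rule mult_strict_right_mono)
      have "\<bar>s (t + h) - s t\<bar> < c / 2" "\<bar>s (t - h) - s t\<bar> < c / 2"
        using d[of "t + h"] d[of "t - h"] h by auto
      then show "s (t + h) - s (t - h) < c" by linarith
    qed (use h in simp)
    finally show False using t h by force
  qed
  ultimately show ?thesis
    using mono_ctble_discont countable_subset by blast
qed

text \<open>
Averaging over the translates of \<open>N\<close> by \<open>t *\<^sub>R v\<close> with \<open>0 \<le> t \<le> 1\<close> leaves its measure unchanged, and
exchanging the order of integration turns the average into an integral of measures of slices, all
zero.
\<close>
lemma negligible_if_countable_on_lines:
  fixes N :: "'a::euclidean_space set"
  assumes N: "N \<in> sets borel" and lines: "\<And>x. countable {t. x + t *\<^sub>R v \<in> N}"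
  shows "negligible N"
proof -
  have meas: "(\<lambda>(t, x). indicator N (x + t *\<^sub>R v) * indicator {0..1} t :: ennreal)
      \<in> borel_measurable (lborel \<Otimes>\<^sub>M lborel)"
  proof -
    have "(\<lambda>p::real \<times> 'a. indicator N (snd p + fst p *\<^sub>R v) * indicator {0..1} (fst p) :: ennreal)
      \<in> borel_measurable (lborel \<Otimes>\<^sub>M lborel)"
      using N by measurable
    then show ?thesis by (simp add: case_prod_unfold)
  qed
  have "emeasure lborel N = (\<integral>\<^sup>+t. emeasure lborel N * indicator {0..1::real} t \<partial>lborel)"
    by (subst nn_integral_cmult) auto
  also have "\<dots> = (\<integral>\<^sup>+t. (\<integral>\<^sup>+x. indicator N (x + t *\<^sub>R v) * indicator {0..1::real} t \<partial>lborel) \<partial>lborel)"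
  proof (rule nn_integral_cong)
    fix t :: real
    have "emeasure lborel N = (\<integral>\<^sup>+x. indicator N x \<partial>distr lborel borel ((+) (t *\<^sub>R v)))"
      using N by (simp add: lborel_distr_plus)
    also have "\<dots> = (\<integral>\<^sup>+x. indicator N (x + t *\<^sub>R v) \<partial>lborel)"
      using N by (subst nn_integral_distr) (auto simp: add.commute)
    finally show "emeasure lborel N * indicator {0..1} t =
        (\<integral>\<^sup>+x. indicator N (x + t *\<^sub>R v) * indicator {0..1} t \<partial>lborel)"
      using N by (subst nn_integral_multc) auto
  qed
  also have "\<dots> = (\<integral>\<^sup>+x. (\<integral>\<^sup>+t. indicator N (x + t *\<^sub>R v) * indicator {0..1::real} t \<partial>lborel) \<partial>lborel)"
    using lborel_pair.Fubini'[OF meas] by simp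
  also have "\<dots> = (\<integral>\<^sup>+(x::'a). 0 \<partial>lborel)"
  proof (rule nn_integral_cong)
    fix x :: 'a
    have "AE t in lborel. t \<notin> {t. x + t *\<^sub>R v \<in> N}"
      by (intro AE_not_in countable_imp_null_set_lborel lines)
    then have "AE t in lborel. indicator N (x + t *\<^sub>R v) * indicator {0..1::real} t = (0::ennreal)"
      by eventually_elim auto
    then show "(\<integral>\<^sup>+t. indicator N (x + t *\<^sub>R v) * indicator {0..1::real} t \<partial>lborel) = 0"
      by (subst nn_integral_cong_AE) auto
  qed
  finally have "N \<in> null_sets lborel" using N by auto
  then show ?thesis
    by (simp add: negligible_iff_null_sets null_sets_completionI)
qed

text \<open>
Subtracting an affine minorant leaves a nonnegative convex \<open>q\<close> with \<open>q 0 = 0\<close>. Since both \<open>q (h b)\<close>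
and \<open>q (- h b)\<close> are nonnegative, the second difference bounds each of them, and convexity passes the
bound on to all smaller steps along the axis. A vector is the average of \<open>n\<close>-fold multiples of
its axis components, so Jensen's inequality combines the axes into \<open>q y \<le> \<epsilon> * norm y\<close>.
\<close>
lemma convex_differentiable_if_no_kinks:
  fixes g :: "'a::euclidean_space \<Rightarrow> real"
  assumes conv: "convex_on UNIV g"
    and smooth: "\<And>b c. b \<in> Basis \<Longrightarrow> c > 0 \<Longrightarrow>
      \<exists>h\<in>{0<..1}. g (x + h *\<^sub>R b) + g (x - h *\<^sub>R b) - 2 * g x < c * h"
  shows "g differentiable (at x)"
proof -
  obtain p where p: "\<And>y. g x + p \<bullet> (y - x) \<le> g y"
    using convex_subgradient_exists[OF conv] by blast
  define q where "q y = g (x + y) + - (g x + p \<bullet> y)" for y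
  have "convex_on UNIV (\<lambda>y. - (g x + p \<bullet> y))"
    by (rule convex_onI) (auto simp: algebra_simps inner_simps)
  then have q_conv: "convex_on UNIV q"
    unfolding q_def by (intro convex_on_add convex_on_translate conv)
  have q_nonneg: "q y \<ge> 0" for y using p[of "x + y"] by (simp add: q_def)
  have [simp]: "q 0 = 0" by (simp add: q_def)
  have q_small: "\<exists>\<rho>>0. \<forall>y. norm y < \<rho> \<longrightarrow> q y \<le> \<epsilon> * norm y" if "\<epsilon> > 0" for \<epsilon>
  proof -
    define n where "n = real DIM('a)"
    have "n > 0" by (simp add: n_def)
    define c where "c = \<epsilon> / n"
    have "c > 0" using \<open>n > 0\<close> that by (simp add: c_def)
    then have "\<forall>b\<in>Basis. \<exists>h\<in>{0<..1}. g (x + h *\<^sub>R b) + g (x - h *\<^sub>R b) - 2 * g x < c * h"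
      using smooth by blast
    then obtain h where "\<forall>b\<in>Basis. h b \<in> {0<..1} \<and>
        g (x + h b *\<^sub>R b) + g (x - h b *\<^sub>R b) - 2 * g x < c * h b"
      unfolding bchoice_iff Bex_def by blast
    then have h: "\<And>b. b \<in> Basis \<Longrightarrow> 0 < h b"
      "\<And>b. b \<in> Basis \<Longrightarrow> g (x + h b *\<^sub>R b) + g (x - h b *\<^sub>R b) - 2 * g x < c * h b"
      by auto
    have axis: "q (k *\<^sub>R b) \<le> c * \<bar>k\<bar>" if b: "b \<in> Basis" and k: "\<bar>k\<bar> \<le> h b" for b k
    proof -
      define e where "e = (if k \<ge> 0 then h b else - h b)"
      have "q (h b *\<^sub>R b) + q (- h b *\<^sub>R b) < c * h b"
        using h(2)[OF b] by (simp add: q_def)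
      then have qe: "q (e *\<^sub>R b) \<le> c * h b"
        using q_nonneg[of "h b *\<^sub>R b"] q_nonneg[of "- h b *\<^sub>R b"] by (auto simp: e_def)
      define \<theta> where "\<theta> = \<bar>k\<bar> / h b"
      have \<theta>: "0 \<le> \<theta>" "\<theta> \<le> 1" "\<theta> * h b = \<bar>k\<bar>" using h(1)[OF b] k by (auto simp: \<theta>_def)
      have "k = \<theta> * e" using \<theta>(3) by (auto simp: e_def)
      then have "q (k *\<^sub>R b) = q ((1 - \<theta>) *\<^sub>R 0 + \<theta> *\<^sub>R (e *\<^sub>R b))" by simp
      also have "\<dots> \<le> (1 - \<theta>) * q 0 + \<theta> * q (e *\<^sub>R b)"
        using \<theta> by (intro convex_onD[OF q_conv]) auto
      also have "\<dots> \<le> \<theta> * (c * h b)" using qe \<theta> by (simp add: mult_left_mono)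
      also have "\<dots> = c * \<bar>k\<bar>" using \<theta>(3) by simp
      finally show ?thesis .
    qed
    define \<rho> where "\<rho> = Min (h ` Basis) / n"
    have "\<rho> > 0" using h(1) \<open>n > 0\<close> by (auto simp: \<rho>_def)
    have "q y \<le> \<epsilon> * norm y" if y: "norm y < \<rho>" for y
    proof -
      have "y = (\<Sum>b\<in>Basis. (1 / n) *\<^sub>R ((n * (y \<bullet> b)) *\<^sub>R b))"
        using \<open>n > 0\<close> by (simp add: euclidean_representation)
      then have "q y = q (\<Sum>b\<in>Basis. (1 / n) *\<^sub>R ((n * (y \<bullet> b)) *\<^sub>R b))" by simp
      also have "\<dots> \<le> (\<Sum>b\<in>Basis. (1 / n) * q ((n * (y \<bullet> b)) *\<^sub>R b))"
        using \<open>n > 0\<close> by (intro convex_on_sum[OF _ _ q_conv]) (auto simp: n_def)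
      also have "\<dots> \<le> (\<Sum>b\<in>(Basis::'a set). (1 / n) * (c * (n * norm y)))"
      proof (intro sum_mono mult_left_mono)
        fix b :: 'a assume b: "b \<in> Basis"
        have "\<bar>n * (y \<bullet> b)\<bar> \<le> n * norm y"
          using \<open>n > 0\<close> Basis_le_norm[OF b, of y] by (simp add: abs_mult)
        moreover have "n * norm y \<le> Min (h ` Basis)"
          using y \<open>n > 0\<close>
          by (simp add: \<rho>_def pos_less_divide_eq mult.commute del: Min_ge_iff Min_gr_iff)
        moreover have "Min (h ` Basis) \<le> h b" using b by simp
        ultimately have "q ((n * (y \<bullet> b)) *\<^sub>R b) \<le> c * \<bar>n * (y \<bullet> b)\<bar>"
          by (intro axis b) linarith
        also have "\<dots> \<le> c * (n * norm y)"
          using \<open>\<bar>n * (y \<bullet> b)\<bar> \<le> n * norm y\<close> \<open>c > 0\<close> by (intro mult_left_mono) auto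
        finally show "q ((n * (y \<bullet> b)) *\<^sub>R b) \<le> c * (n * norm y)" .
      qed (use \<open>n > 0\<close> in auto)
      also have "\<dots> = \<epsilon> * norm y"
        using \<open>n > 0\<close> by (simp add: c_def n_def[symmetric])
      finally show ?thesis .
    qed
    then show ?thesis using \<open>\<rho> > 0\<close> by blast
  qed
  have "(g has_derivative (\<lambda>h. p \<bullet> h)) (at x)"
    unfolding has_derivative_at_alt
  proof (intro conjI allI impI)
    show "bounded_linear ((\<bullet>) p)" by (rule bounded_linear_inner_right)
    fix \<epsilon> :: real assume "\<epsilon> > 0"
    then obtain \<rho> where "\<rho> > 0" and \<rho>: "\<And>y. norm y < \<rho> \<Longrightarrow> q y \<le> \<epsilon> * norm y"
      using q_small by blast
    have "norm (g y - g x - p \<bullet> (y - x)) \<le> \<epsilon> * norm (y - x)" if "norm (y - x) < \<rho>" for y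
      using \<rho>[OF that] q_nonneg[of "y - x"] by (simp add: q_def)
    then show "\<exists>d>0. \<forall>y. norm (y - x) < d \<longrightarrow>
        norm (g y - g x - p \<bullet> (y - x)) \<le> \<epsilon> * norm (y - x)"
      using \<open>\<rho> > 0\<close> by blast
  qed
  then show ?thesis by (rule differentiableI)
qed

text \<open>
The kinks along a fixed axis of size at least \<open>c\<close> form a
closed set with countable intersection with every line parallel to that axis.
\<close>
lemma negligible_nondifferentiability_convex:
  fixes g :: "'a::euclidean_space \<Rightarrow> real"
  assumes conv: "convex_on UNIV g"
  shows "negligible (nondifferentiability_set g)"
proof -
  have cont: "continuous_on UNIV g"
    using conv by (simp add: convex_on_continuous)
  define K where "K b c = {x. \<forall>h\<in>{0<..1}. c * h \<le> g (x + h *\<^sub>R b) + g (x - h *\<^sub>R b) - 2 * g x}"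
    for b c
  have "negligible (K b c)" if "c > 0" for b c
  proof (rule negligible_if_countable_on_lines)
    have "closed {x. c * h \<le> g (x + h *\<^sub>R b) + g (x - h *\<^sub>R b) - 2 * g x}" for h
      by (intro closed_Collect_le continuous_intros continuous_on_compose2[OF cont]) auto
    moreover have "K b c = (\<Inter>h\<in>{0<..1}. {x. c * h \<le> g (x + h *\<^sub>R b) + g (x - h *\<^sub>R b) - 2 * g x})"
      by (auto simp: K_def)
    ultimately have "closed (K b c)" by (simp add: closed_INT)
    then show "K b c \<in> sets borel" by (rule borel_closed)
    fix x
    have "convex_on UNIV (\<lambda>t::real. g (x + t *\<^sub>R b))"
    proof (rule convex_onI)
      fix t u v :: real assume "0 < t" "t < 1"
      moreover have "x + ((1 - t) *\<^sub>R u + t *\<^sub>R v) *\<^sub>R b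
          = (1 - t) *\<^sub>R (x + u *\<^sub>R b) + t *\<^sub>R (x + v *\<^sub>R b)"
        by (simp add: algebra_simps)
      ultimately show "g (x + ((1 - t) *\<^sub>R u + t *\<^sub>R v) *\<^sub>R b)
          \<le> (1 - t) * g (x + u *\<^sub>R b) + t * g (x + v *\<^sub>R b)"
        using convex_onD[OF conv, of t "x + u *\<^sub>R b" "x + v *\<^sub>R b"] by simp
    qed auto
    from countable_kinks[OF this that] show "countable {t. x + t *\<^sub>R b \<in> K b c}"
      by (simp add: K_def algebra_simps)
  qed
  then have "negligible (\<Union>b\<in>Basis. \<Union>m. K b (1 / real (Suc m)))"
    by (intro negligible_Union_nat negligible_Union) auto
  moreover have "nondifferentiability_set g \<subseteq> (\<Union>b\<in>Basis. \<Union>m. K b (1 / real (Suc m)))"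
  proof
    fix x assume "x \<in> nondifferentiability_set g"
    then obtain b c where bc: "b \<in> Basis" "c > 0"
      "\<And>h. h \<in> {0<..1} \<Longrightarrow> c * h \<le> g (x + h *\<^sub>R b) + g (x - h *\<^sub>R b) - 2 * g x"
      using convex_differentiable_if_no_kinks[OF conv, of x]
      by (force simp: nondifferentiability_set_def not_less)
    obtain m where "1 / real (Suc m) < c"
      using \<open>c > 0\<close> reals_Archimedean by (metis inverse_eq_divide)
    then have "x \<in> K b (1 / real (Suc m))"
      using bc(3) unfolding K_def
      by (smt (verit) mem_Collect_eq greaterThanAtMost_iff mult_right_mono)
    then show "x \<in> (\<Union>b\<in>Basis. \<Union>m. K b (1 / real (Suc m)))" using bc(1) by blast
  qed
  ultimately show ?thesis by (rule negligible_subset)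
qed

text \<open>
Here the limits of gradients have to be shown rich enough. If \<open>0\<close> were not in their convex hull, a
vector \<open>a\<close> would have inner product larger than some \<open>c > 0\<close> with all of them. Approach the minimizer
\<open>x\<close> from the direction \<open>- a\<close> through points of differentiability outside \<open>S\<close>, which are dense. Comparing
\<open>g x\<close> with the subgradient inequality at these points makes their gradients have nonpositive inner
product with a direction that tends to \<open>a\<close>; a cluster point of the gradients contradicts the choice of \<open>a\<close>.
\<close>
lemma convex_minimizer_critical:
  fixes g :: "'a::euclidean_space \<Rightarrow> real"
  assumes conv: "convex_on UNIV g" and S: "negligible S" and min: "\<And>y. g x \<le> g y"
  shows "x \<in> critical_points S g"
proof (rule ccontr)
  define P where "P = (\<lambda>w. (w, gradient g w)) ` (- (nondifferentiability_set g \<union> S))"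
  \<comment> \<open>Limits of gradients are a slice of the closure of the graph of the gradient, hence form a closed set.\<close>
  define V where "V = {v. (x, v) \<in> closure P}"
  have "V = {v. \<exists>\<xi>. \<xi> \<longlonglongrightarrow> x \<and> (\<forall>k. \<xi> k \<notin> nondifferentiability_set g \<union> S) \<and>
                         (\<lambda>k. gradient g (\<xi> k)) \<longlonglongrightarrow> v}" (is "_ = ?W")
  proof (intro set_eqI iffI)
    fix v assume "v \<in> V"
    then obtain \<zeta> where \<zeta>: "\<And>k. \<zeta> k \<in> P" "\<zeta> \<longlonglongrightarrow> (x, v)"
      unfolding V_def closure_sequential by blast
    have "snd (\<zeta> k) = gradient g (fst (\<zeta> k)) \<and> fst (\<zeta> k) \<notin> nondifferentiability_set g \<union> S" for k
      using \<zeta>(1)[of k] by (auto simp: P_def)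
    moreover have "(\<lambda>k. fst (\<zeta> k)) \<longlonglongrightarrow> x" "(\<lambda>k. snd (\<zeta> k)) \<longlonglongrightarrow> v"
      using tendsto_fst[OF \<zeta>(2)] tendsto_snd[OF \<zeta>(2)] by auto
    ultimately show "v \<in> ?W" by auto
  next
    fix v assume "v \<in> ?W"
    then obtain \<xi> where "\<xi> \<longlonglongrightarrow> x" "\<forall>k. \<xi> k \<notin> nondifferentiability_set g \<union> S"
      "(\<lambda>k. gradient g (\<xi> k)) \<longlonglongrightarrow> v" by blast
    then show "v \<in> V"
      unfolding V_def closure_sequential mem_Collect_eq
      by (intro exI[of _ "\<lambda>k. (\<xi> k, gradient g (\<xi> k))"]) (auto simp: P_def intro!: tendsto_Pair)
  qed
  then have gg: "generalized_gradient S g x = convex hull V"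
    unfolding generalized_gradient_def by simp
  assume "x \<notin> critical_points S g"
  then have "0 \<notin> convex hull V" by (simp add: critical_points_def gg)
  have "closed V"
  proof -
    have "V = (\<lambda>v. (x, v)) -` closure P" by (auto simp: V_def)
    then show ?thesis by (auto intro!: closed_vimage continuous_intros)
  qed
  moreover have "bounded V"
  proof -
    obtain B where "\<And>v. (\<And>y. g x + v \<bullet> (y - x) \<le> g y) \<Longrightarrow> norm v \<le> B"
      using subgradients_bounded_on_cball[OF conv, of "norm x"] by (metis order_refl)
    moreover have "v \<in> generalized_gradient S g x" if "v \<in> V" for v
      using that by (simp add: gg hull_inc)
    ultimately have "norm v \<le> B" if "v \<in> V" for v
      using that limit_gradient_subgradient[OF conv] by blast
    then show ?thesis by (auto simp: bounded_iff)
  qed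
  ultimately have "compact (convex hull V)"
    by (intro compact_convex_hull) (simp add: compact_eq_bounded_closed)
  then obtain a c where "c > 0" and sep: "\<And>v. v \<in> convex hull V \<Longrightarrow> c < a \<bullet> v"
    using separating_hyperplane_closed_0[OF convex_convex_hull compact_imp_closed \<open>0 \<notin> convex hull V\<close>]
    by blast
  have neg: "negligible (nondifferentiability_set g \<union> S)"
    using S negligible_nondifferentiability_convex[OF conv] by (simp add: negligible_Un)
  have dense: "\<exists>w. w \<notin> nondifferentiability_set g \<union> S \<and> dist w y < r" if "r > 0" for y r
  proof -
    have "\<not> ball y r \<subseteq> nondifferentiability_set g \<union> S"
      using negligible_subset[OF neg] open_not_negligible[of "ball y r"] that by auto
    then show ?thesis by (auto simp: dist_commute)
  qed
  define \<tau> where "\<tau> k = 1 / real (Suc k)" for k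
  have \<tau>: "\<tau> k > 0" for k by (simp add: \<tau>_def)
  have \<tau>0: "\<tau> \<longlonglongrightarrow> 0"
    unfolding \<tau>_def using LIMSEQ_inverse_real_of_nat by (simp add: inverse_eq_divide)
  \<comment> \<open>An error of order \<open>\<tau> k * \<tau> k\<close> is negligible against the step \<open>\<tau> k\<close>, so the rescaled directions tend to \<open>a\<close>.\<close>
  obtain w where w: "\<And>k. w k \<notin> nondifferentiability_set g \<union> S"
    "\<And>k. dist (w k) (x - \<tau> k *\<^sub>R a) < \<tau> k * \<tau> k"
  proof -
    have "\<forall>k. \<exists>w. w \<notin> nondifferentiability_set g \<union> S \<and> dist w (x - \<tau> k *\<^sub>R a) < \<tau> k * \<tau> k"
      using dense \<tau> by simp
    from choice[OF this] show ?thesis using that by blast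
  qed
  define d where "d k = (x - w k) /\<^sub>R \<tau> k" for k
  have d: "(\<lambda>k. d k) \<longlonglongrightarrow> a"
  proof (rule Lim_null_comparison[THEN LIM_zero_cancel])
    show "\<forall>\<^sub>F k in sequentially. norm (d k - a) \<le> \<tau> k"
    proof (rule always_eventually, rule allI)
      fix k
      have "norm (d k - a) = norm ((x - \<tau> k *\<^sub>R a - w k) /\<^sub>R \<tau> k)"
        using \<tau>[of k] by (simp add: d_def algebra_simps)
      also have "\<dots> = dist (w k) (x - \<tau> k *\<^sub>R a) / \<tau> k"
        using \<tau>[of k] by (simp add: dist_norm norm_minus_commute divide_inverse_commute)
      also have "\<dots> \<le> \<tau> k" using w(2)[of k] \<tau>[of k] by (simp add: field_simps)
      finally show "norm (d k - a) \<le> \<tau> k" .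
    qed
  qed (rule \<tau>0)
  have "(\<lambda>k. x - \<tau> k *\<^sub>R d k) \<longlonglongrightarrow> x - 0 *\<^sub>R a"
    by (intro tendsto_intros \<tau>0 d)
  moreover have "x - \<tau> k *\<^sub>R d k = w k" for k using \<tau>[of k] by (simp add: d_def)
  ultimately have wx: "w \<longlonglongrightarrow> x" by simp
  then obtain R where R: "\<And>k. norm (w k) \<le> R"
    using convergent_imp_bounded bounded_iff by (metis rangeI)
  have subgr: "g (w k) + gradient g (w k) \<bullet> (y - w k) \<le> g y" for k y
    using convex_gradient_subgradient[OF conv] w(1) by (auto simp: nondifferentiability_set_def)
  obtain B where "\<And>x v. norm x \<le> R \<Longrightarrow> (\<And>y. g x + v \<bullet> (y - x) \<le> g y) \<Longrightarrow> norm v \<le> B"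
    using subgradients_bounded_on_cball[OF conv] by blast
  then have "norm (gradient g (w k)) \<le> B" for k
    using R subgr by blast
  then have "bounded (range (\<lambda>k. gradient g (w k)))" by (auto simp: bounded_iff)
  then obtain l r where "strict_mono (r :: nat \<Rightarrow> nat)" and l: "(\<lambda>k. gradient g (w (r k))) \<longlonglongrightarrow> l"
    using bounded_imp_convergent_subsequence unfolding comp_def by blast
  then have wr: "(\<lambda>k. w (r k)) \<longlonglongrightarrow> x" "(\<lambda>k. d (r k)) \<longlonglongrightarrow> a"
    using LIMSEQ_subseq_LIMSEQ[OF wx] LIMSEQ_subseq_LIMSEQ[OF d] by (auto simp: comp_def)
  then have "l \<in> V"
    using l w(1) unfolding V_def closure_sequential mem_Collect_eq
    by (intro exI[of _ "\<lambda>k. (w (r k), gradient g (w (r k)))"]) (auto simp: P_def intro!: tendsto_Pair)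
  then have "a \<bullet> l > 0" using sep[of l] \<open>c > 0\<close> by (simp add: hull_inc)
  moreover have "d (r k) \<bullet> gradient g (w (r k)) \<le> 0" for k
  proof -
    have "gradient g (w (r k)) \<bullet> (x - w (r k)) \<le> 0"
      using subgr[of "r k" x] min[of "w (r k)"] by linarith
    then show ?thesis
      using \<tau>[of "r k"] by (simp add: d_def inner_commute mult_le_0_iff)
  qed
  then have "a \<bullet> l \<le> 0"
    by (intro LIMSEQ_le_const2[OF tendsto_inner[OF wr(2) l]]) auto
  ultimately show False by simp
qed

section \<open>Asymptotics of saddle-point dynamics\<close>

text \<open>
Graph and cost enter the argument only through a symmetric positive semidefinite \<open>L\<close> and a convex
\<open>g\<close>. The point \<open>(x0, z0)\<close> is a saddle point of the Lagrangian \<open>g x + z \<bullet> L x\<close>, which is what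
\<open>feasible\<close> and \<open>multiplier\<close> express.
\<close>
locale saddle_dynamics =
  fixes g :: "'a::euclidean_space \<Rightarrow> real" and L :: "'a \<Rightarrow> 'a" and S :: "'a set"
    and \<gamma> :: "real \<Rightarrow> 'a \<times> 'a" and x0 z0 :: 'a
  assumes conv: "convex_on UNIV g"
    and lin: "linear L" and sym: "L x \<bullet> y = x \<bullet> L y"
    and psd: "0 \<le> x \<bullet> L x" and ker: "x \<bullet> L x = 0 \<Longrightarrow> L x = 0"
    and feasible: "L x0 = 0" and multiplier: "0 \<le> g x - g x0 + z0 \<bullet> L x"
    and traj: "trajectory (\<lambda>(x, z). {(u, w). u + L x + L z \<in> uminus ` generalized_gradient S g x \<and>
        w = L x}) \<gamma>"
begin

abbreviation F where
  "F \<equiv> (\<lambda>(x, z). {(u, w). u + L x + L z \<in> uminus ` generalized_gradient S g x \<and> w = L x})"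

definition V :: "'a \<times> 'a \<Rightarrow> real" where
  "V p = (p - (x0, z0)) \<bullet> (p - (x0, z0)) / 2"

text \<open>
The dissipation rate: the disagreement \<open>x \<bullet> L x\<close> plus the gap of the Lagrangian at the multiplier
\<open>z0\<close>.
\<close>
definition W :: "'a \<Rightarrow> real" where
  "W x = x \<bullet> L x + (g x - g x0 + z0 \<bullet> L x)"

lemma W_nonneg: "0 \<le> W x"
  using psd multiplier by (simp add: W_def)

lemma V_nonneg: "0 \<le> V p"
  by (simp add: V_def)

lemma W_eq_0_imp_arg_min:
  assumes "W x = 0"
  shows "is_arg_min g (\<lambda>y. L y = 0) x"
proof -
  have "x \<bullet> L x = 0" "g x - g x0 + z0 \<bullet> L x = 0"
    using assms psd[of x] multiplier[of x] by (auto simp: W_def)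
  moreover from this have "L x = 0" using ker by blast
  moreover have "g x0 \<le> g y" if "L y = 0" for y
    using multiplier[of y] that by simp
  ultimately show ?thesis by (force simp: is_arg_min_def)
qed

lemma continuous_W: "continuous_on A W"
proof -
  have "continuous_on A g"
    using convex_on_continuous[OF open_UNIV conv] continuous_on_subset by blast
  moreover have "continuous_on A L"
    using lin by (simp add: linear_continuous_on linear_linear)
  ultimately show ?thesis unfolding W_def by (intro continuous_intros)
qed

text \<open>
The coupling terms \<open>x \<bullet> L z\<close> of the two components cancel, and the subgradient inequality at \<open>x\<close>,
evaluated at \<open>x0\<close>, produces the gap \<open>g x - g x0\<close>.
\<close>
lemma V_derivative_le:
  assumes "(u, w) \<in> F (x, z)"
  shows "((x, z) - (x0, z0)) \<bullet> (u, w) \<le> - W x"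
proof -
  obtain s where s: "s \<in> generalized_gradient S g x" and u: "u = - L x - L z - s" and w: "w = L x"
    using assms by (auto simp: algebra_simps eq_neg_iff_add_eq_0)
  have "g x + s \<bullet> (x0 - x) \<le> g x0"
    using limit_gradient_subgradient[OF conv s] .
  moreover have "(x - x0) \<bullet> L y = x \<bullet> L y" for y
    using sym[of x0 y] feasible by (simp add: inner_diff_left)
  then have "(x - x0) \<bullet> u = - (x \<bullet> L x) - x \<bullet> L z + s \<bullet> (x0 - x)"
    unfolding u by (simp add: inner_diff_right inner_diff_left inner_commute)
  moreover have "(z - z0) \<bullet> w = x \<bullet> L z - z0 \<bullet> L x"
    unfolding w inner_diff_left using sym[of x z] by (metis inner_commute)
  ultimately show ?thesis by (simp add: W_def)
qed

lemma bounded_on_interval: "bounded (\<gamma> ` {a..b})" if "0 \<le> a"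
proof -
  have "absolutely_continuous_on {0..\<bar>b\<bar> + 1} \<gamma>"
    using traj by (simp add: trajectory_def)
  then have "absolutely_continuous_on {a..b} \<gamma>"
    by (rule absolutely_continuous_on_subset) (use that in auto)
  then show ?thesis
    by (intro compact_imp_bounded compact_continuous_image absolutely_continuous_imp_continuous_on) auto
qed

lemma V_decrease:
  assumes ab: "0 \<le> a" "a \<le> b" and c: "\<And>t. a \<le> t \<Longrightarrow> t \<le> b \<Longrightarrow> c \<le> W (fst (\<gamma> t))"
  shows "V (\<gamma> b) \<le> V (\<gamma> a) - c * (b - a)"
proof -
  have "bounded ((\<lambda>p. p - (x0, z0)) ` \<gamma> ` {a..b})"
    using bounded_translation_minus[OF bounded_on_interval[OF ab(1)]] .
  then obtain M where M: "\<And>t. a \<le> t \<Longrightarrow> t \<le> b \<Longrightarrow> norm (\<gamma> t - (x0, z0)) \<le> M"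
    by (auto simp: bounded_iff image_iff) (meson atLeastAtMost_iff)
  have "V (\<gamma> b) - V (\<gamma> a) \<le> (- c) * (b - a)"
  proof (rule trajectory_increment_le[OF traj ab, where K=M and \<phi>'="\<lambda>p v. (p - (x0, z0)) \<bullet> v"])
    fix u v assume uv: "a \<le> u" "u \<le> v" "v \<le> b"
    define p q where "p = \<gamma> v - (x0, z0)" and "q = \<gamma> u - (x0, z0)"
    have "V (\<gamma> v) - V (\<gamma> u) = ((p + q) \<bullet> (p - q)) / 2"
      by (simp add: V_def p_def[symmetric] q_def[symmetric] inner_diff_right inner_add_left inner_commute[of q p])
    also have "\<dots> \<le> norm (p + q) * norm (p - q) / 2"
      by (simp add: norm_cauchy_schwarz)
    also have "\<dots> \<le> (M + M) * norm (p - q) / 2"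
      using M[of u] M[of v] uv unfolding p_def[symmetric] q_def[symmetric]
      by (intro divide_right_mono mult_right_mono norm_triangle_le add_mono) auto
    also have "p - q = \<gamma> v - \<gamma> u" by (simp add: p_def q_def)
    finally show "V (\<gamma> v) - V (\<gamma> u) \<le> M * norm (\<gamma> v - \<gamma> u)" by simp
  next
    fix p show "(V has_derivative (\<lambda>v. (p - (x0, z0)) \<bullet> v)) (at p)"
      unfolding V_def by (auto intro!: derivative_eq_intros simp: inner_commute)
  next
    fix t v assume t: "a \<le> t" "t \<le> b" and "v \<in> F (\<gamma> t)"
    then have "(\<gamma> t - (x0, z0)) \<bullet> v \<le> - W (fst (\<gamma> t))"
      using V_derivative_le[of "fst v" "snd v" "fst (\<gamma> t)" "snd (\<gamma> t)"] by simp
    then show "(\<gamma> t - (x0, z0)) \<bullet> v \<le> - c" using c[OF t] by simp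
  qed
  then show ?thesis by simp
qed

lemma trajectory_bounded:
  obtains R where "R > 0" "\<And>t. 0 \<le> t \<Longrightarrow> norm (\<gamma> t) \<le> R"
proof -
  define R where "R = sqrt (2 * V (\<gamma> 0)) + norm (x0, z0) + 1"
  have "R > 0" using V_nonneg[of "\<gamma> 0"] by (simp add: R_def add_nonneg_pos)
  moreover have "norm (\<gamma> t) \<le> R" if "0 \<le> t" for t
  proof -
    have "V (\<gamma> t) \<le> V (\<gamma> 0)" using V_decrease[of 0 t 0] that W_nonneg by simp
    then have "norm (\<gamma> t - (x0, z0)) \<le> sqrt (2 * V (\<gamma> 0))"
      by (simp add: V_def norm_eq_sqrt_inner)
    then show ?thesis
      using norm_triangle_ineq2[of "\<gamma> t" "(x0, z0)"] by (simp add: R_def)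
  qed
  ultimately show ?thesis using that by blast
qed

lemma trajectory_lipschitz:
  obtains C where "C > 0" "\<And>a b. 0 \<le> a \<Longrightarrow> a \<le> b \<Longrightarrow> norm (\<gamma> b - \<gamma> a) \<le> C * (b - a)"
proof -
  obtain R where "R > 0" and R: "\<And>t. 0 \<le> t \<Longrightarrow> norm (\<gamma> t) \<le> R"
    using trajectory_bounded by blast
  obtain B where "B > 0" and B: "\<And>x s. norm x \<le> R \<Longrightarrow> (\<And>y. g x + s \<bullet> (y - x) \<le> g y) \<Longrightarrow> norm s \<le> B"
    using subgradients_bounded_on_cball[OF conv] by blast
  obtain k where "k > 0" and k: "\<And>x. norm (L x) \<le> norm x * k"
    using bounded_linear.pos_bounded[of L] lin by (auto simp: linear_linear)
  define C where "C = 3 * (R * k) + B"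
  have "C > 0" using \<open>R > 0\<close> \<open>k > 0\<close> \<open>B > 0\<close> by (auto simp: C_def intro!: add_pos_pos)
  have speed: "norm v \<le> C" if t: "0 \<le> t" "v \<in> F (\<gamma> t)" for t v
  proof -
    obtain x z where xz: "\<gamma> t = (x, z)" by fastforce
    obtain s where s: "s \<in> generalized_gradient S g x" "v = (- L x - L z - s, L x)"
      using t(2) by (cases v) (auto simp: xz algebra_simps eq_neg_iff_add_eq_0)
    have "norm x \<le> R" "norm z \<le> R"
      using R[OF t(1)] norm_fst_le[of x z] norm_snd_le[of z x] by (simp_all add: xz)
    then have "norm (L x) \<le> R * k" "norm (L z) \<le> R * k"
      using k[of x] k[of z] \<open>k > 0\<close> by (meson mult_right_mono less_imp_le order_trans)+
    moreover have "norm s \<le> B"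
      using B[OF \<open>norm x \<le> R\<close>] limit_gradient_subgradient[OF conv s(1)] by blast
    moreover have "norm v \<le> norm (- L x - L z - s) + norm (L x)"
      unfolding s(2) by (rule norm_Pair_le)
    moreover have "norm (- L x - L z - s) \<le> norm (L x) + norm (L z) + norm s"
      by (metis norm_minus_cancel norm_triangle_le_diff norm_triangle_ineq4 add_right_mono order_trans)
    ultimately show ?thesis by (simp add: C_def)
  qed
  have "norm (\<gamma> b - \<gamma> a) \<le> C * (b - a)" if ab: "0 \<le> a" "a \<le> b" for a b
  proof (cases "\<gamma> b = \<gamma> a")
    case False
    define e where "e = \<gamma> b - \<gamma> a"
    have "e \<bullet> \<gamma> b - e \<bullet> \<gamma> a \<le> (norm e * C) * (b - a)"
    proof (rule trajectory_increment_le[OF traj ab, where K="norm e" and \<phi>="\<lambda>p. e \<bullet> p" and \<phi>'="\<lambda>p v. e \<bullet> v"])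
      fix u v show "e \<bullet> \<gamma> v - e \<bullet> \<gamma> u \<le> norm e * norm (\<gamma> v - \<gamma> u)"
        by (metis inner_diff_right norm_cauchy_schwarz)
    next
      fix p show "((\<lambda>p. e \<bullet> p) has_derivative (\<lambda>v. e \<bullet> v)) (at p)"
        by (auto intro!: derivative_eq_intros)
    next
      fix t v assume "a \<le> t" "t \<le> b" "v \<in> F (\<gamma> t)"
      then have "norm v \<le> C" using speed[of t v] ab by linarith
      then show "e \<bullet> v \<le> norm e * C"
        by (meson mult_left_mono norm_cauchy_schwarz norm_ge_zero order_trans)
    qed
    then have "norm e * norm e \<le> norm e * (C * (b - a))"
      by (simp add: e_def inner_diff_right[symmetric] dot_square_norm power2_eq_square mult.assoc)
    then show ?thesis using False by (simp add: e_def)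
  qed (use \<open>C > 0\<close> ab in simp)
  then show ?thesis using that \<open>C > 0\<close> by blast
qed

text \<open>
Barbalat's argument. Along the trajectory \<open>W\<close> is uniformly continuous, so each time with \<open>W \<ge> \<epsilon>\<close>
starts an interval of fixed length \<open>\<eta>\<close> with \<open>W \<ge> \<epsilon> / 2\<close>, on which \<open>V\<close> drops by a fixed amount. This
cannot happen once \<open>V\<close> is close to its infimum.
\<close>
lemma W_tendsto_0: "((\<lambda>t. W (fst (\<gamma> t))) \<longlongrightarrow> 0) at_top"
proof (rule order_tendstoI)
  fix c :: real assume "c < 0"
  then show "\<forall>\<^sub>F t in at_top. c < W (fst (\<gamma> t))"
    using W_nonneg by (intro always_eventually) (auto intro: less_le_trans)
next
  fix \<epsilon> :: real assume "0 < \<epsilon>"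
  obtain R where R: "\<And>t. 0 \<le> t \<Longrightarrow> norm (fst (\<gamma> t)) \<le> R"
    using trajectory_bounded by (metis norm_fst_le order_trans prod.collapse)
  obtain C where "C > 0" and C: "\<And>a b. 0 \<le> a \<Longrightarrow> a \<le> b \<Longrightarrow> norm (\<gamma> b - \<gamma> a) \<le> C * (b - a)"
    using trajectory_lipschitz by blast
  have "uniformly_continuous_on (cball 0 R) W"
    by (intro compact_uniformly_continuous continuous_W compact_cball)
  then obtain \<delta> where "\<delta> > 0" and \<delta>: "\<And>x y. norm x \<le> R \<Longrightarrow> norm y \<le> R \<Longrightarrow> dist y x < \<delta> \<Longrightarrow>
      dist (W y) (W x) < \<epsilon> / 2"
    using \<open>0 < \<epsilon>\<close> unfolding uniformly_continuous_on_def
    by (metis half_gt_zero mem_cball_0)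
  define \<eta> where "\<eta> = \<delta> / (2 * C)"
  have "\<eta> > 0" using \<open>\<delta> > 0\<close> \<open>C > 0\<close> by (simp add: \<eta>_def)
  have drop: "V (\<gamma> (t + \<eta>)) \<le> V (\<gamma> t) - \<epsilon> / 2 * \<eta>" if "0 \<le> t" "\<epsilon> \<le> W (fst (\<gamma> t))" for t
  proof -
    have "\<epsilon> / 2 \<le> W (fst (\<gamma> s))" if s: "t \<le> s" "s \<le> t + \<eta>" for s
    proof -
      have "norm (fst (\<gamma> s) - fst (\<gamma> t)) \<le> norm (\<gamma> s - \<gamma> t)"
        by (metis fst_diff norm_fst_le prod.collapse)
      also have "\<dots> \<le> C * (s - t)" using C \<open>0 \<le> t\<close> s by simp
      also have "\<dots> \<le> C * \<eta>" using s \<open>C > 0\<close> by simp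
      also have "\<dots> < \<delta>" using \<open>C > 0\<close> \<open>\<delta> > 0\<close> by (simp add: \<eta>_def)
      finally have "dist (W (fst (\<gamma> s))) (W (fst (\<gamma> t))) < \<epsilon> / 2"
        using R s \<open>0 \<le> t\<close> by (intro \<delta>) (simp_all add: dist_norm)
      then show ?thesis using \<open>\<epsilon> \<le> W (fst (\<gamma> t))\<close>
        unfolding dist_real_def by linarith
    qed
    then show ?thesis using V_decrease[of t "t + \<eta>" "\<epsilon> / 2"] \<open>0 \<le> t\<close> \<open>\<eta> > 0\<close> by simp
  qed
  define m where "m = Inf ((\<lambda>t. V (\<gamma> t)) ` {0..})"
  have bdd: "bdd_below ((\<lambda>t. V (\<gamma> t)) ` {0..})"
    using V_nonneg by (intro bdd_belowI2)
  have m: "m \<le> V (\<gamma> t)" if "0 \<le> t" for t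
    unfolding m_def using that bdd by (intro cInf_lower) auto
  have "\<exists>y\<in>(\<lambda>t. V (\<gamma> t)) ` {0..}. y < m + \<epsilon> / 2 * \<eta>"
    using \<open>\<epsilon> > 0\<close> \<open>\<eta> > 0\<close> bdd unfolding m_def by (subst cInf_less_iff[symmetric]) auto
  then obtain T where "0 \<le> T" and T: "V (\<gamma> T) < m + \<epsilon> / 2 * \<eta>" by auto
  have "W (fst (\<gamma> t)) < \<epsilon>" if "T \<le> t" for t
  proof (rule ccontr)
    assume "\<not> W (fst (\<gamma> t)) < \<epsilon>"
    then have "V (\<gamma> (t + \<eta>)) \<le> V (\<gamma> t) - \<epsilon> / 2 * \<eta>"
      using drop that \<open>0 \<le> T\<close> by simp
    moreover have "V (\<gamma> t) \<le> V (\<gamma> T)"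
      using V_decrease[of T t 0] that \<open>0 \<le> T\<close> W_nonneg by simp
    moreover have "m \<le> V (\<gamma> (t + \<eta>))" using m that \<open>0 \<le> T\<close> \<open>\<eta> > 0\<close> by simp
    ultimately show False using T by linarith
  qed
  then show "\<forall>\<^sub>F t in at_top. W (fst (\<gamma> t)) < \<epsilon>"
    unfolding eventually_at_top_linorder by blast
qed

text \<open>
On the compact part of the range of the trajectory that keeps a distance \<open>\<epsilon>\<close> from the minimizers,
\<open>W\<close> is continuous and positive, hence bounded away from 0.
\<close>
lemma infdist_arg_min_tendsto_0:
  "((\<lambda>t. infdist (fst (\<gamma> t)) {x. is_arg_min g (\<lambda>y. L y = 0) x}) \<longlongrightarrow> 0) at_top"
  (is "((\<lambda>t. infdist _ ?M) \<longlongrightarrow> 0) at_top")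
proof (rule order_tendstoI)
  fix c :: real assume "c < 0"
  then show "\<forall>\<^sub>F t in at_top. c < infdist (fst (\<gamma> t)) ?M"
    by (intro always_eventually) (auto intro: less_le_trans infdist_nonneg)
next
  fix \<epsilon> :: real assume "0 < \<epsilon>"
  obtain R where R: "\<And>t. 0 \<le> t \<Longrightarrow> norm (fst (\<gamma> t)) \<le> R"
    using trajectory_bounded by (metis norm_fst_le order_trans prod.collapse)
  define K where "K = cball 0 R \<inter> {x. \<epsilon> \<le> infdist x ?M}"
  have "compact K"
    unfolding K_def
    by (intro compact_Int_closed compact_cball closed_Collect_le continuous_intros continuous_on_infdist)
  have "\<exists>\<mu>>0. \<forall>x\<in>K. \<mu> \<le> W x"
  proof (cases "K = {}")
    case False
    then obtain k where "k \<in> K" and k: "\<And>x. x \<in> K \<Longrightarrow> W k \<le> W x"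
      using continuous_attains_inf[OF \<open>compact K\<close> _ continuous_W] by blast
    have "k \<notin> ?M" using \<open>k \<in> K\<close> \<open>0 < \<epsilon>\<close> by (auto simp: K_def)
    then have "W k \<noteq> 0" using W_eq_0_imp_arg_min by blast
    then have "W k > 0" using W_nonneg[of k] by simp
    then show ?thesis using k by blast
  qed (auto intro: zero_less_one)
  then obtain \<mu> where "\<mu> > 0" and \<mu>: "\<And>x. x \<in> K \<Longrightarrow> \<mu> \<le> W x" by blast
  have "\<forall>\<^sub>F t in at_top. W (fst (\<gamma> t)) < \<mu>"
    using order_tendstoD(2)[OF W_tendsto_0 \<open>\<mu> > 0\<close>] .
  then show "\<forall>\<^sub>F t in at_top. infdist (fst (\<gamma> t)) ?M < \<epsilon>"
    using eventually_ge_at_top[of 0]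
  proof eventually_elim
    case (elim t)
    have "norm (fst (\<gamma> t)) \<le> R" using R[OF elim(2)] .
    moreover have "fst (\<gamma> t) \<notin> K" using \<mu> elim(1) by force
    ultimately show ?case by (auto simp: K_def)
  qed
qed

end

section \<open>The network Laplacian\<close>

lemma symmetric_imp_adjoint:
  fixes M :: "real ^ 'm ^ 'm"
  assumes "transpose M = M"
  shows "(M *v x) \<bullet> y = x \<bullet> (M *v y)"
  using assms by (metis dot_lmul_matrix vector_transpose_matrix)

lemma undirected_imp_symmetric:
  assumes "undirected A"
  shows "A $ i $ j = A $ j $ i"
proof (cases "i = j")
  case False
  have "laplacian A $ i $ j = laplacian A $ j $ i"
    using assms unfolding undirected_def by (metis transpose_def vec_lambda_beta)
  then show ?thesis using False by (simp add: laplacian_def out_degree_matrix_def)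
qed simp

lemma transpose_network_laplacian:
  assumes "undirected A"
  shows "transpose (network_laplacian A) = network_laplacian A"
proof -
  have "laplacian A $ i $ j = laplacian A $ j $ i" for i j
    using undirected_imp_symmetric[OF assms] by (auto simp: laplacian_def out_degree_matrix_def)
  then show ?thesis
    by (auto simp: transpose_def network_laplacian_def kronecker_def mat_def vec_eq_iff)
qed

lemma network_laplacian_nth:
  fixes x :: "real ^ ('n::finite \<times> 'd::finite)"
  shows "(network_laplacian A *v x) $ (i, k) = (\<Sum>j\<in>UNIV. A $ i $ j * (x $ (i, k) - x $ (j, k)))"
proof -
  have "(network_laplacian A *v x) $ (i, k)
      = (\<Sum>q\<in>UNIV. laplacian A $ i $ fst q * (if k = snd q then 1 else 0) * x $ q)"
    by (simp add: matrix_vector_mult_def network_laplacian_def kronecker_def mat_def)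
  also have "\<dots> = (\<Sum>j\<in>UNIV. \<Sum>l\<in>UNIV. laplacian A $ i $ j * (if k = l then 1 else 0) * x $ (j, l))"
    unfolding UNIV_Times_UNIV[symmetric] by (subst sum.cartesian_product) (simp add: case_prod_unfold)
  also have "\<dots> = (\<Sum>j\<in>UNIV. laplacian A $ i $ j * x $ (j, k))"
    by (intro sum.cong refl) (simp add: if_distrib if_distribR cong: if_cong)
  also have "\<dots> = (\<Sum>j\<in>UNIV. (if i = j then (\<Sum>l\<in>UNIV. A $ i $ l) * x $ (j, k) else 0)
      - A $ i $ j * x $ (j, k))"
    by (intro sum.cong refl) (auto simp: laplacian_def out_degree_matrix_def algebra_simps)
  also have "\<dots> = (\<Sum>j\<in>UNIV. A $ i $ j * (x $ (i, k) - x $ (j, k)))"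
    by (simp add: sum_subtractf right_diff_distrib sum_distrib_right)
  finally show ?thesis .
qed

text \<open>
By symmetry of the weights, exchanging \<open>i\<close> and \<open>j\<close> turns \<open>x\<^sub>j (x\<^sub>i - x\<^sub>j)\<close> into \<open>- x\<^sub>i (x\<^sub>i - x\<^sub>j)\<close>; adding
both versions completes the square.
\<close>
lemma network_laplacian_quadratic_form:
  fixes x :: "real ^ ('n::finite \<times> 'd::finite)"
  assumes "undirected A"
  shows "x \<bullet> (network_laplacian A *v x)
    = (\<Sum>k\<in>UNIV. \<Sum>i\<in>UNIV. \<Sum>j\<in>UNIV. A $ i $ j * (x $ (i, k) - x $ (j, k))\<^sup>2) / 2"
proof -
  define e where "e k i j = A $ i $ j * (x $ (i, k) - x $ (j, k))" for k i j
  have "(\<Sum>i\<in>UNIV. \<Sum>j\<in>UNIV. A $ i $ j * (x $ (i, k) - x $ (j, k))\<^sup>2)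
      = 2 * (\<Sum>i\<in>UNIV. \<Sum>j\<in>UNIV. x $ (i, k) * e k i j)" for k
  proof -
    have "(\<Sum>i\<in>UNIV. \<Sum>j\<in>UNIV. x $ (j, k) * e k i j) = (\<Sum>i\<in>UNIV. \<Sum>j\<in>UNIV. - (x $ (i, k) * e k i j))"
      by (subst sum.swap, intro sum.cong refl)
        (auto simp: e_def undirected_imp_symmetric[OF assms] algebra_simps
          intro: undirected_imp_symmetric[OF assms])
    then show ?thesis
      by (simp add: e_def power2_eq_square algebra_simps sum_subtractf sum.distrib sum_negf
          sum_distrib_left)
  qed
  moreover have "x \<bullet> (network_laplacian A *v x) = (\<Sum>k\<in>UNIV. \<Sum>i\<in>UNIV. \<Sum>j\<in>UNIV. x $ (i, k) * e k i j)"
  proof -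
    have "x \<bullet> (network_laplacian A *v x)
        = (\<Sum>i\<in>UNIV. \<Sum>k\<in>UNIV. x $ (i, k) * (network_laplacian A *v x) $ (i, k))"
      unfolding inner_vec_def UNIV_Times_UNIV[symmetric]
      by (subst sum.cartesian_product) (simp add: case_prod_unfold)
    then show ?thesis
      by (subst sum.swap) (simp add: network_laplacian_nth e_def sum_distrib_left)
  qed
  ultimately show ?thesis by (simp add: sum_distrib_left[symmetric])
qed

lemma weighted_digraph_nonneg:
  assumes "weighted_digraph E A"
  shows "0 \<le> A $ i $ j"
  using assms unfolding weighted_digraph_def by (metis less_imp_le order_refl)

lemma network_laplacian_psd:
  assumes "weighted_digraph E A" "undirected A"
  shows "0 \<le> x \<bullet> (network_laplacian A *v x)"
  using weighted_digraph_nonneg[OF assms(1)]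
  by (simp add: network_laplacian_quadratic_form[OF assms(2)] sum_nonneg)

lemma network_laplacian_form_eq_0:
  fixes x :: "real ^ ('n::finite \<times> 'd::finite)"
  assumes "weighted_digraph E A" "undirected A" and "x \<bullet> (network_laplacian A *v x) = 0"
  shows "A $ i $ j = 0 \<or> x $ (i, k) = x $ (j, k)"
proof -
  note nn = weighted_digraph_nonneg[OF assms(1)]
  have "(\<Sum>k\<in>UNIV. \<Sum>i\<in>UNIV. \<Sum>j\<in>UNIV. A $ i $ j * (x $ (i, k) - x $ (j, k))\<^sup>2) = 0"
    using assms(3) by (simp add: network_laplacian_quadratic_form[OF assms(2)])
  then have "(\<Sum>i\<in>UNIV. \<Sum>j\<in>UNIV. A $ i $ j * (x $ (i, k) - x $ (j, k))\<^sup>2) = 0"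
    by (subst (asm) sum_nonneg_eq_0_iff) (auto intro!: sum_nonneg mult_nonneg_nonneg nn)
  then have "(\<Sum>j\<in>UNIV. A $ i $ j * (x $ (i, k) - x $ (j, k))\<^sup>2) = 0"
    by (subst (asm) sum_nonneg_eq_0_iff) (auto intro!: sum_nonneg mult_nonneg_nonneg nn)
  then have "A $ i $ j * (x $ (i, k) - x $ (j, k))\<^sup>2 = 0"
    by (subst (asm) sum_nonneg_eq_0_iff) (auto intro!: mult_nonneg_nonneg nn)
  then show ?thesis by simp
qed

lemma network_laplacian_form_eq_0_imp_ker:
  fixes x :: "real ^ ('n::finite \<times> 'd::finite)"
  assumes "weighted_digraph E A" "undirected A" and "x \<bullet> (network_laplacian A *v x) = 0"
  shows "network_laplacian A *v x = 0"
proof -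
  have "(network_laplacian A *v x) $ (i, k) = 0" for i k
    using network_laplacian_form_eq_0[OF assms, of i _ k]
    unfolding network_laplacian_nth by (intro sum.neutral) auto
  then show ?thesis by (simp add: vec_eq_iff)
qed

lemma ker_network_laplacian_consensus:
  fixes x :: "real ^ ('n::finite \<times> 'd::finite)"
  assumes "weighted_digraph E A" "undirected A" "connected_graph E"
    and ker: "network_laplacian A *v x = 0"
  shows "agent_state x i = agent_state x j"
proof (cases "i = j")
  case False
  have edge: "agent_state x a = agent_state x b" if "(a, b) \<in> E" for a b
  proof -
    have "A $ a $ b \<noteq> 0"
      using assms(1) that unfolding weighted_digraph_def by (metis less_irrefl)
    then show ?thesis
      using network_laplacian_form_eq_0[OF assms(1,2), of x a b] ker
      by (simp add: agent_state_def vec_eq_iff)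
  qed
  have "(i, j) \<in> E\<^sup>+" using assms(3) False by (simp add: connected_graph_def)
  then show ?thesis by (induction rule: trancl_induct) (auto dest: edge)
qed simp

section \<open>Consensus states and the constrained problem\<close>

definition consensus_state :: "real ^ 'd \<Rightarrow> real ^ ('n::finite \<times> 'd::finite)" where
  "consensus_state y = (\<chi> p. y $ snd p)"

lemma agent_state_consensus [simp]: "agent_state (consensus_state y) i = y"
  by (simp add: agent_state_def consensus_state_def vec_eq_iff)

lemma network_laplacian_consensus [simp]: "network_laplacian A *v consensus_state y = 0"
proof -
  have "(network_laplacian A *v consensus_state y) $ (i, k) = 0" for i k
    unfolding network_laplacian_nth by (simp add: consensus_state_def)
  then show ?thesis by (simp add: vec_eq_iff)
qed

lemma network_cost_consensus [simp]: "network_cost f (consensus_state y) = total_cost f y"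
  by (simp add: network_cost_def total_cost_def)

lemma consensus_eqI:
  assumes "\<And>i. agent_state x i = y"
  shows "x = consensus_state y"
proof -
  have "x $ (i, k) = y $ k" for i k
    using assms[of i] by (auto simp: agent_state_def vec_eq_iff)
  then show ?thesis by (simp add: consensus_state_def vec_eq_iff)
qed

lemma convex_on_finite_sum:
  assumes "finite I" "convex C" "\<And>i. i \<in> I \<Longrightarrow> convex_on C (h i)"
  shows "convex_on C (\<lambda>x. \<Sum>i\<in>I. h i x)"
  using assms by (induction I rule: finite_induct) (auto simp: convex_on_const intro: convex_on_add)

lemma convex_total_cost:
  assumes "\<And>i. convex_on UNIV (f i)"
  shows "convex_on UNIV (total_cost f)"
  unfolding total_cost_def using assms by (intro convex_on_finite_sum) auto

lemma convex_network_cost: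
  assumes "\<And>i. convex_on UNIV (f i)"
  shows "convex_on UNIV (network_cost f)"
  unfolding network_cost_def
proof (intro convex_on_finite_sum)
  fix i
  show "convex_on UNIV (\<lambda>x. f i (agent_state x i))"
  proof (rule convex_onI)
    fix t :: real and x y :: "real ^ ('a \<times> 'b)" assume "0 < t" "t < 1"
    moreover have "agent_state ((1 - t) *\<^sub>R x + t *\<^sub>R y) i
        = (1 - t) *\<^sub>R agent_state x i + t *\<^sub>R agent_state y i"
      by (simp add: agent_state_def vec_eq_iff)
    ultimately show "f i (agent_state ((1 - t) *\<^sub>R x + t *\<^sub>R y) i)
        \<le> (1 - t) * f i (agent_state x i) + t * f i (agent_state y i)"
      using convex_onD[OF assms, of t "agent_state x i" "agent_state y i"] by simp
  qed auto
qed auto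

lemma constrained_solutions_eq:
  fixes f :: "'n::finite \<Rightarrow> real ^ 'd::finite \<Rightarrow> real" and A :: "real ^ 'n ^ 'n"
  assumes "weighted_digraph E A" "undirected A" "connected_graph E"
  shows "constrained_solutions A f = consensus_state ` {y. \<forall>y'. total_cost f y \<le> total_cost f y'}"
proof (intro set_eqI iffI)
  fix x :: "real ^ ('n \<times> 'd)"
  assume "x \<in> constrained_solutions A f"
  then have x: "network_laplacian A *v x = 0"
    "\<And>y. network_laplacian A *v y = 0 \<Longrightarrow> network_cost f x \<le> network_cost f y"
    by (auto simp: constrained_solutions_def is_arg_min_linorder)
  define y where "y = agent_state x undefined"
  have "x = consensus_state y"
    using ker_network_laplacian_consensus[OF assms x(1)] unfolding y_def by (intro consensus_eqI)
  moreover have "total_cost f y \<le> total_cost f y'" for y'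
    using x(2)[of "consensus_state y'"] by (simp add: \<open>x = consensus_state y\<close>)
  ultimately show "x \<in> consensus_state ` {y. \<forall>y'. total_cost f y \<le> total_cost f y'}" by blast
next
  fix x :: "real ^ ('n \<times> 'd)"
  assume "x \<in> consensus_state ` {y. \<forall>y'. total_cost f y \<le> total_cost f y'}"
  then obtain y where y: "x = consensus_state y" "\<And>y'. total_cost f y \<le> total_cost f y'" by blast
  have "network_cost f x \<le> network_cost f x'" if "network_laplacian A *v x' = 0" for x'
  proof -
    have "x' = consensus_state (agent_state x' undefined)"
      using ker_network_laplacian_consensus[OF assms that] by (intro consensus_eqI)
    then show ?thesis using y by (metis network_cost_consensus)
  qed
  then show "x \<in> constrained_solutions A f"
    by (simp add: y(1) constrained_solutions_def is_arg_min_linorder)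
qed

text \<open>
The minimizers of a convex function form a convex set of critical points, and a nondegenerate segment
is infinite.
\<close>
lemma finite_critical_imp_unique_minimizer:
  fixes g :: "'a::euclidean_space \<Rightarrow> real"
  assumes conv: "convex_on UNIV g" and "negligible S" and fin: "finite (critical_points S g)"
    and x: "\<And>w. g x \<le> g w" and y: "\<And>w. g y \<le> g w"
  shows "x = y"
proof (rule ccontr)
  assume "x \<noteq> y"
  have "closed_segment x y \<subseteq> critical_points S g"
  proof
    fix p assume "p \<in> closed_segment x y"
    then obtain t where t: "0 \<le> t" "t \<le> 1" "p = (1 - t) *\<^sub>R x + t *\<^sub>R y"
      by (auto simp: closed_segment_def)
    have "g x = g y" using x[of y] y[of x] by simp
    have "g p \<le> (1 - t) * g x + t * g y"
      unfolding t(3) using t by (intro convex_onD[OF conv]) auto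
    also have "\<dots> = g x" by (simp add: \<open>g x = g y\<close> algebra_simps)
    finally show "p \<in> critical_points S g"
      using x by (intro convex_minimizer_critical assms) (meson order_trans)
  qed
  then have "finite (closed_segment x y)" using fin finite_subset by blast
  then show False using \<open>x \<noteq> y\<close> by simp
qed

section \<open>Convergence of the distributed dynamics\<close>

theorem mainTheorem1:
  fixes E :: "('n::finite \<times> 'n) set"
    and A :: "real ^ 'n ^ 'n"
    and f :: "'n \<Rightarrow> real ^ 'd::finite \<Rightarrow> real"
    and \<gamma> :: "real \<Rightarrow> (real ^ ('n \<times> 'd)) \<times> (real ^ ('n \<times> 'd))"
    and S :: "(real ^ ('n \<times> 'd)) set"
    and S' :: "(real ^ 'd) set"
  assumes "weighted_digraph E A"
    and "undirected A"
    and "connected_graph E"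
    and "\<And>i. locally_lipschitz (f i)"
    and "\<And>i. convex_on UNIV (f i)"
    and "negligible S"
    and "negligible S'"
    and "constrained_solutions A f \<noteq> {}"
    and "trajectory (optimization_dynamics S A f) \<gamma>"
  shows "((\<lambda>t. infdist (fst (\<gamma> t)) (constrained_solutions A f)) \<longlongrightarrow> 0) at_top \<and>
         (finite (critical_points S' (total_cost f)) \<longrightarrow>
            (\<exists>l\<in>constrained_solutions A f. ((\<lambda>t. fst (\<gamma> t)) \<longlongrightarrow> l) at_top))"
proof -
  note graph = \<open>weighted_digraph E A\<close> \<open>undirected A\<close>
  let ?L = "\<lambda>x::real ^ ('n \<times> 'd). network_laplacian A *v x"
  let ?g = "network_cost f"
  have conv: "convex_on UNIV ?g" using assms(5) by (rule convex_network_cost)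
  have lin: "linear ?L" by simp
  have sym: "?L x \<bullet> y = x \<bullet> ?L y" for x y
    by (intro symmetric_imp_adjoint transpose_network_laplacian graph)
  obtain x0 where "x0 \<in> constrained_solutions A f" using assms(8) by blast
  then have x0: "?L x0 = 0" "\<And>y. ?L y = 0 \<Longrightarrow> ?g x0 \<le> ?g y"
    by (auto simp: constrained_solutions_def is_arg_min_linorder)
  obtain z0 where z0: "\<And>x. 0 \<le> ?g x - ?g x0 + z0 \<bullet> ?L x"
    using convex_lagrange_multiplier[OF conv lin sym x0(2)] by blast
  interpret saddle_dynamics ?g ?L S \<gamma> x0 z0
  proof (rule saddle_dynamics.intro)
    show "trajectory (\<lambda>(x, z). {(u, w). u + ?L x + ?L z \<in> uminus ` generalized_gradient S ?g x \<and>
        w = ?L x}) \<gamma>"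
      using assms(9) by (simp add: optimization_dynamics_def)
  qed (rule conv lin sym x0(1) z0 network_laplacian_psd[OF graph]
      network_laplacian_form_eq_0_imp_ker[OF graph] | assumption)+
  have lim: "((\<lambda>t. infdist (fst (\<gamma> t)) (constrained_solutions A f)) \<longlongrightarrow> 0) at_top"
    using infdist_arg_min_tendsto_0 by (simp add: constrained_solutions_def)
  moreover have "((\<lambda>t. fst (\<gamma> t)) \<longlongrightarrow> x0) at_top" if fin: "finite (critical_points S' (total_cost f))"
  proof -
    have "x = x0" if x: "x \<in> constrained_solutions A f" for x
    proof -
      note sol = constrained_solutions_eq[OF assms(1-3), of f]
      from x sol obtain y where y: "x = consensus_state y" "\<And>w. total_cost f y \<le> total_cost f w"
        by auto
      from \<open>x0 \<in> constrained_solutions A f\<close> sol obtain y0 where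
        y0: "x0 = consensus_state y0" "\<And>w. total_cost f y0 \<le> total_cost f w"
        by auto
      have "y = y0"
        using finite_critical_imp_unique_minimizer[OF convex_total_cost[OF assms(5)]
            \<open>negligible S'\<close> fin y(2) y0(2)] .
      then show ?thesis using y(1) y0(1) by simp
    qed
    then have "constrained_solutions A f = {x0}"
      using \<open>x0 \<in> constrained_solutions A f\<close> by blast
    then show ?thesis using lim by (subst tendsto_dist_iff) simp
  qed
  ultimately show ?thesis using \<open>x0 \<in> constrained_solutions A f\<close> by blast
qed

end
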